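(* Let $R$ be a Dedekind domain, $S\subseteq R$ a multiplicatively closed subset with $0\notin S$, $R_S=S^{-1}R$, and $H=\ker(\mathrm{Pic}(R)\to\mathrm{Pic}(R_S))$. Then for every $n\ge1$ there is an isomorphism of simplicial complexes $\mathcal{T}_n(R_S)\cong\mathcal{T}_n(R,H)$ (given on vertices by $P\mapsto P\otimes_R R_S$, with inverse $V\mapsto V\cap R^n$).
   Context: A flag in $A^n$ ($A$ commutative) is a chain of free direct summands $0\subsetneq V_1\subsetneq\cdots\subsetneq V_k\subsetneq A^n$; complete if $k=n-1$, good if a subflag of a complete flag. The Tits complex $\mathcal{T}_n(A)$ has vertices the direct summands $V$ of $A^n$, $0\ne V\ne A^n$, with $V$ and $A^n/V$ free, and a $k$-simplex for every good flag with $k+1$ terms. $\mathrm{Pic}(R)$ is the group of isomorphism classes of rank one projective modules under $\otimes_R$; for a Dedekind domain it is canonically identified with $\tilde K_0(R)$, the group of finitely generated projective modules modulo $P\sim Q$ iff $P\oplus R^a\cong Q\oplus R^b$ for some $a,b$ (group operation $\oplus$); write $[P]$ for the class of $P$. For a subgroup $H\le\mathrm{Pic}(R)$, $\mathcal{T}_n(R,H)$ is the nerve of the poset of direct summands $P$ of $R^n$, $0\ne P\ne R^n$, with $[P]\in H$, where $P<Q$ iff $P\subsetneq Q$ and $P$ is a direct summand of $Q$. *)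

theory Defs
  imports "HOL-Computational_Algebra.Fraction_Field" "HOL-Computational_Algebra.Polynomial" "HOL-Library.Function_Algebras"
begin

definition is_ideal :: "'a::comm_ring_1 set \<Rightarrow> bool" where
  "is_ideal I \<longleftrightarrow> 0 \<in> I \<and> (\<forall>x\<in>I. \<forall>y\<in>I. x + y \<in> I) \<and> (\<forall>r x. x \<in> I \<longrightarrow> r * x \<in> I)"

definition fin_gen_ideal :: "'a::comm_ring_1 set \<Rightarrow> bool" where
  "fin_gen_ideal I \<longleftrightarrow> (\<exists>F. finite F \<and> I = {\<Sum>f\<in>F. r f * f | r. True})"

definition prime_ideal :: "'a::comm_ring_1 set \<Rightarrow> bool" where
  "prime_ideal P \<longleftrightarrow> is_ideal P \<and> P \<noteq> UNIV \<and> (\<forall>a b. a * b \<in> P \<longrightarrow> a \<in> P \<or> b \<in> P)"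

definition maximal_ideal :: "'a::comm_ring_1 set \<Rightarrow> bool" where
  "maximal_ideal M \<longleftrightarrow> is_ideal M \<and> M \<noteq> UNIV \<and>
     (\<forall>I. is_ideal I \<and> M \<subseteq> I \<longrightarrow> I = M \<or> I = UNIV)"

definition dedekind_domain :: "'a::idom itself \<Rightarrow> bool" where
  "dedekind_domain _ \<longleftrightarrow>
     (\<forall>I::'a set. is_ideal I \<longrightarrow> fin_gen_ideal I) \<and>
     (\<forall>P::'a set. prime_ideal P \<and> P \<noteq> {0} \<longrightarrow> maximal_ideal P) \<and>
     (\<forall>(x::'a fract) (p::'a poly). lead_coeff p = 1 \<and> poly (map_poly (\<lambda>a. Fraction_Field.Fract a 1) p) x = 0
        \<longrightarrow> x \<in> range (\<lambda>a. Fraction_Field.Fract a 1))"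

definition base_ring :: "'a::idom fract set" where
  "base_ring = range (\<lambda>a. Fraction_Field.Fract a 1)"

definition loc_ring :: "'a::idom set \<Rightarrow> 'a fract set" where
  "loc_ring S = {Fraction_Field.Fract a s | a s. s \<in> S}"

section \<open>Modules over a subring A of a field, inside K^n (vectors nat => K, zero from n on)\<close>

definition std_mod :: "'k::field set \<Rightarrow> nat \<Rightarrow> (nat \<Rightarrow> 'k) set" where
  "std_mod A n = {v. (\<forall>i<n. v i \<in> A) \<and> (\<forall>i\<ge>n. v i = 0)}"

definition smult_vec :: "'k::field \<Rightarrow> (nat \<Rightarrow> 'k) \<Rightarrow> (nat \<Rightarrow> 'k)" where
  "smult_vec c v = (\<lambda>i. c * v i)"

definition lincomb :: "(nat \<Rightarrow> 'k::field) \<Rightarrow> (nat \<Rightarrow> 'k) list \<Rightarrow> (nat \<Rightarrow> 'k)" where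
  "lincomb c vs = (\<lambda>j. \<Sum>i<length vs. c i * (vs ! i) j)"

definition is_submod :: "'k::field set \<Rightarrow> (nat \<Rightarrow> 'k) set \<Rightarrow> bool" where
  "is_submod A M \<longleftrightarrow> 0 \<in> M \<and> (\<forall>x\<in>M. \<forall>y\<in>M. x + y \<in> M) \<and> (\<forall>c\<in>A. \<forall>x\<in>M. smult_vec c x \<in> M)"

definition span_in :: "'k::field set \<Rightarrow> (nat \<Rightarrow> 'k) set \<Rightarrow> (nat \<Rightarrow> 'k) set" where
  "span_in A X = {lincomb c vs | c vs. set vs \<subseteq> X \<and> (\<forall>i<length vs. c i \<in> A)}"

definition lin_indep :: "'k::field set \<Rightarrow> (nat \<Rightarrow> 'k) list \<Rightarrow> bool" where
  "lin_indep A bs \<longleftrightarrow> (\<forall>c. (\<forall>i<length bs. c i \<in> A) \<and> lincomb c bs = 0 \<longrightarrow> (\<forall>i<length bs. c i = 0))"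

definition free_mod :: "'k::field set \<Rightarrow> (nat \<Rightarrow> 'k) set \<Rightarrow> bool" where
  "free_mod A M \<longleftrightarrow> (\<exists>bs. set bs \<subseteq> M \<and> lin_indep A bs \<and>
      M = {lincomb c bs | c. \<forall>i<length bs. c i \<in> A})"

definition free_quot :: "'k::field set \<Rightarrow> (nat \<Rightarrow> 'k) set \<Rightarrow> (nat \<Rightarrow> 'k) set \<Rightarrow> bool" where
  "free_quot A N M \<longleftrightarrow> (\<exists>bs. set bs \<subseteq> N \<and>
      (\<forall>c. (\<forall>i<length bs. c i \<in> A) \<and> lincomb c bs \<in> M \<longrightarrow> (\<forall>i<length bs. c i = 0)) \<and>
      N = {lincomb c bs + m | c m. (\<forall>i<length bs. c i \<in> A) \<and> m \<in> M})"

definition direct_summand :: "'k::field set \<Rightarrow> (nat \<Rightarrow> 'k) set \<Rightarrow> (nat \<Rightarrow> 'k) set \<Rightarrow> bool" where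
  "direct_summand A M N \<longleftrightarrow> is_submod A M \<and> M \<subseteq> N \<and>
     (\<exists>Q. is_submod A Q \<and> Q \<subseteq> N \<and> M \<inter> Q = {0} \<and> N = {x + y | x y. x \<in> M \<and> y \<in> Q})"

definition iso_mod :: "'k::field set \<Rightarrow> (nat \<Rightarrow> 'k) set \<Rightarrow> (nat \<Rightarrow> 'k) set \<Rightarrow> bool" where
  "iso_mod A M N \<longleftrightarrow> (\<exists>f. bij_betw f M N \<and> (\<forall>x\<in>M. \<forall>y\<in>M. f (x + y) = f x + f y) \<and>
      (\<forall>c\<in>A. \<forall>x\<in>M. f (smult_vec c x) = smult_vec c (f x)))"

text \<open>External direct sum M (+) A^a, for M inside K^n, realised inside K^(n+a).\<close>
definition dsum_std :: "'k::field set \<Rightarrow> nat \<Rightarrow> (nat \<Rightarrow> 'k) set \<Rightarrow> nat \<Rightarrow> (nat \<Rightarrow> 'k) set" where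
  "dsum_std A n M a = {(\<lambda>i. if i < n then v i else w (i - n)) | v w. v \<in> M \<and> w \<in> std_mod A a}"

text \<open>Class of M in the reduced K_0 group is zero: M (+) A^a = A^b.\<close>
definition stably_free :: "'k::field set \<Rightarrow> nat \<Rightarrow> (nat \<Rightarrow> 'k) set \<Rightarrow> bool" where
  "stably_free A n M \<longleftrightarrow> (\<exists>a b. iso_mod A (dsum_std A n M a) (std_mod A b))"

definition tits_vertex :: "'k::field set \<Rightarrow> nat \<Rightarrow> (nat \<Rightarrow> 'k) set \<Rightarrow> bool" where
  "tits_vertex A n V \<longleftrightarrow> direct_summand A V (std_mod A n) \<and> V \<noteq> {0} \<and> V \<noteq> std_mod A n \<and>
     free_mod A V \<and> free_quot A (std_mod A n) V"

definition is_flag :: "'k::field set \<Rightarrow> nat \<Rightarrow> (nat \<Rightarrow> 'k) set list \<Rightarrow> bool" where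
  "is_flag A n Vs \<longleftrightarrow> sorted_wrt (\<subset>) Vs \<and>
     (\<forall>V\<in>set Vs. direct_summand A V (std_mod A n) \<and> free_mod A V \<and> V \<noteq> {0} \<and> V \<noteq> std_mod A n)"

definition complete_flag :: "'k::field set \<Rightarrow> nat \<Rightarrow> (nat \<Rightarrow> 'k) set list \<Rightarrow> bool" where
  "complete_flag A n Vs \<longleftrightarrow> is_flag A n Vs \<and> length Vs = n - 1"

definition tits_simplex :: "'k::field set \<Rightarrow> nat \<Rightarrow> (nat \<Rightarrow> 'k) set set \<Rightarrow> bool" where
  "tits_simplex A n \<sigma> \<longleftrightarrow> finite \<sigma> \<and> \<sigma> \<noteq> {} \<and> (\<forall>V\<in>\<sigma>. tits_vertex A n V) \<and>
     (\<exists>Vs. complete_flag A n Vs \<and> \<sigma> \<subseteq> set Vs)"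

text \<open>P (x)_R R_S, for P inside R^n, realised as the R_S-span of P inside K^n (R_S is flat).\<close>
definition tensor_loc :: "'a::idom set \<Rightarrow> (nat \<Rightarrow> 'a fract) set \<Rightarrow> (nat \<Rightarrow> 'a fract) set" where
  "tensor_loc S P = span_in (loc_ring S) P"

text \<open>[P] in H iff the image of [P] in K~_0(R_S) vanishes, i.e. P (x) R_S is stably free.\<close>
definition rel_vertex :: "'a::idom set \<Rightarrow> nat \<Rightarrow> (nat \<Rightarrow> 'a fract) set \<Rightarrow> bool" where
  "rel_vertex S n P \<longleftrightarrow> direct_summand base_ring P (std_mod base_ring n) \<and> P \<noteq> {0} \<and>
     P \<noteq> std_mod base_ring n \<and> stably_free (loc_ring S) n (tensor_loc S P)"

definition summand_less :: "'k::field set \<Rightarrow> (nat \<Rightarrow> 'k) set \<Rightarrow> (nat \<Rightarrow> 'k) set \<Rightarrow> bool" where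
  "summand_less A P Q \<longleftrightarrow> P \<subset> Q \<and> direct_summand A P Q"

definition rel_simplex :: "'a::idom set \<Rightarrow> nat \<Rightarrow> (nat \<Rightarrow> 'a fract) set set \<Rightarrow> bool" where
  "rel_simplex S n \<sigma> \<longleftrightarrow> finite \<sigma> \<and> \<sigma> \<noteq> {} \<and> (\<forall>P\<in>\<sigma>. rel_vertex S n P) \<and>
     (\<forall>P\<in>\<sigma>. \<forall>Q\<in>\<sigma>. P = Q \<or> summand_less base_ring P Q \<or> summand_less base_ring Q P)"

end

theory Submission
  imports Defs "HOL-Computational_Algebra.Polynomial_Factorial"
begin

text \<open>
  Both complexes are described by subspaces \<open>W\<close> of \<open>K\<^sup>n\<close>, where \<open>K\<close> is the fraction field of the Dedekind
  domain \<open>R\<close>: over \<open>A = R\<close> and over \<open>A = R\<^sub>S\<close> the direct summands of \<open>A\<^sup>n\<close> are exactly the modules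
  \<open>W \<inter> A\<^sup>n\<close>. One direction is saturation of summands; the other uses that every nonzero vector of \<open>K\<^sup>n\<close> spans an
  invertible fractional ideal, which yields a \<open>K\<close>-linear projection onto \<open>W\<close> preserving \<open>R\<^sup>n\<close>. So
  \<open>P \<mapsto> P \<otimes> R\<^sub>S\<close> and \<open>V \<mapsto> V \<inter> R\<^sup>n\<close> are inverse bijections, and inclusions of summands are again summands.

  The conditions of freeness match because \<open>R\<^sub>S\<close> has stable range two: a nonzero element \<open>a\<close> and any \<open>b\<close> satisfy
  \<open>b\<^sup>N (1 - b x) \<in> (a)\<close> for suitable \<open>N\<close> and \<open>x\<close>. Hence free summands can be cancelled, stably free modules
  and complements of free summands are free, and a chain of free summands can be refined one rank at a time to a
  complete flag.
\<close>

section \<open>Ideals of Dedekind domains\<close>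

text \<open>The two complexes put different demands on a module. Membership of [P] in H is encoded
  as stable freeness of the localized module, with nothing said about the quotient or about flags;
  the Tits complex wants V free, its quotient free, and flags that extend to complete ones. Closing
  this gap is the purpose of the cancellation argument, which works by elementary basis changes
  instead of the structure theory of projective modules. R_S is never shown to be a Dedekind domain.
  What is needed over R_S is carried over from R by clearing denominators: the projections, because
  they are K-linear, and the power condition, because it is an identity between elements. Conversely
  R is treated as the localization at {1}, so that the statements on summands need a single proof.
  The power condition expresses that R/(a) has dimension zero. It serves twice: it drives the stable
  range argument, and it supplies the element outside the ring with which invertibility of
  fractional ideals is proved.\<close>

lemma is_idealD:
  assumes "is_ideal I"
  shows "0 \<in> I" "x \<in> I \<Longrightarrow> y \<in> I \<Longrightarrow> x + y \<in> I" "x \<in> I \<Longrightarrow> r * x \<in> I" "x \<in> I \<Longrightarrow> x * r \<in> I"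
    "x \<in> I \<Longrightarrow> y \<in> I \<Longrightarrow> x - y \<in> I"
proof -
  show "0 \<in> I" "x \<in> I \<Longrightarrow> y \<in> I \<Longrightarrow> x + y \<in> I" "x \<in> I \<Longrightarrow> r * x \<in> I" "x \<in> I \<Longrightarrow> x * r \<in> I"
    using assms by (auto simp: is_ideal_def mult.commute[of x])
  show "x - y \<in> I" if "x \<in> I" "y \<in> I"
  proof -
    have "x + (- 1) * y \<in> I" using assms that unfolding is_ideal_def by blast
    then show ?thesis by simp
  qed
qed

lemma is_ideal_principal: "is_ideal (range ((*) (a::'a::comm_ring_1)))"
  unfolding is_ideal_def
proof (intro conjI ballI allI impI)
  show "0 \<in> range ((*) a)" by (rule image_eqI[of _ _ 0]) auto
  fix x y assume "x \<in> range ((*) a)" "y \<in> range ((*) a)"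
  then show "x + y \<in> range ((*) a)" by (auto simp flip: distrib_left)
next
  fix r x assume "x \<in> range ((*) a)"
  then show "r * x \<in> range ((*) a)" by (auto simp: mult.left_commute)
qed

lemma is_ideal_add_principal:
  fixes P :: "'a::comm_ring_1 set"
  assumes P: "is_ideal P"
  shows "is_ideal {p + r * a | p r. p \<in> P}" "P \<subseteq> {p + r * a | p r. p \<in> P}" "a \<in> {p + r * a | p r. p \<in> P}"
proof -
  let ?X = "{p + r * a | p r. p \<in> P}"
  show "is_ideal ?X"
    unfolding is_ideal_def
  proof (intro conjI ballI allI impI)
    show "0 \<in> ?X" using is_idealD(1)[OF P] by (intro CollectI exI[of _ 0]) auto
    fix x y assume "x \<in> ?X" "y \<in> ?X"
    then obtain p r q s where "x = p + r * a" "y = q + s * a" "p \<in> P" "q \<in> P" by blast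
    then show "x + y \<in> ?X" using is_idealD(2)[OF P]
      by (intro CollectI exI[of _ "p + q"] exI[of _ "r + s"]) (auto simp: algebra_simps)
  next
    fix t x assume "x \<in> ?X"
    then obtain p r where "x = p + r * a" "p \<in> P" by blast
    then show "t * x \<in> ?X" using is_idealD(3)[OF P]
      by (intro CollectI exI[of _ "t * p"] exI[of _ "t * r"]) (auto simp: algebra_simps)
  qed
  show "P \<subseteq> ?X"
    by (intro subsetI CollectI, rule exI, rule exI[of _ 0]) auto
  show "a \<in> ?X"
    using is_idealD(1)[OF P] by (intro CollectI exI[of _ 0] exI[of _ 1]) auto
qed

lemma fin_gen_idealE:
  assumes "fin_gen_ideal I" "is_ideal I"
  obtains F where "finite F" "F \<subseteq> I" "\<And>x. x \<in> I \<Longrightarrow> \<exists>r. x = (\<Sum>f\<in>F. r f * f)"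
proof -
  obtain F where F: "finite F" "I = {\<Sum>f\<in>F. r f * f | r. True}"
    using assms unfolding fin_gen_ideal_def by blast
  have "g \<in> I" if "g \<in> F" for g
  proof -
    have "g = (\<Sum>f\<in>F. (if f = g then 1 else 0) * f)"
      using F(1) that by (simp add: if_distrib[of "\<lambda>c. c * _"] cong: if_cong)
    then show ?thesis unfolding F(2)
      by (intro CollectI exI[of _ "\<lambda>f. if f = g then 1 else 0"] conjI TrueI)
  qed
  then have "F \<subseteq> I" by blast
  moreover have "\<exists>r. x = (\<Sum>f\<in>F. r f * f)" if "x \<in> I" for x using that unfolding F(2) by simp
  ultimately show thesis by (rule that[OF F(1)])
qed

text \<open>An ideal P maximal among those that contain I and avoid T is prime: if a and b lie
  outside P, enlarging P by either one meets T, and the product of two such elements of T would lie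
  in P as soon as a b does.\<close>

lemma prime_ideal_disjoint_from_submonoid:
  fixes I T :: "'a::comm_ring_1 set"
  assumes I: "is_ideal I" and one: "1 \<in> T" and mult: "\<And>x y. x \<in> T \<Longrightarrow> y \<in> T \<Longrightarrow> x * y \<in> T"
    and disj: "I \<inter> T = {}"
  obtains P where "prime_ideal P" "I \<subseteq> P" "P \<inter> T = {}"
proof -
  define Z where "Z = {J. is_ideal J \<and> I \<subseteq> J \<and> J \<inter> T = {}}"
  have "\<exists>P\<in>Z. \<forall>X\<in>Z. P \<subseteq> X \<longrightarrow> X = P"
  proof (rule subset_Zorn_nonempty)
    show "Z \<noteq> {}" using I disj by (auto simp: Z_def)
    fix C assume C: "C \<noteq> {}" "subset.chain Z C"
    then have id: "J \<in> C \<Longrightarrow> is_ideal J" for J by (auto simp: Z_def subset.chain_def)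
    have "is_ideal (\<Union>C)"
      unfolding is_ideal_def
    proof (intro conjI ballI allI impI)
      show "0 \<in> \<Union>C" using C(1) id is_idealD(1) by blast
      fix x y assume "x \<in> \<Union>C" "y \<in> \<Union>C"
      then obtain X Y where XY: "X \<in> C" "Y \<in> C" "x \<in> X" "y \<in> Y" by blast
      then have "X \<subseteq> Y \<or> Y \<subseteq> X" using C(2) unfolding subset.chain_def by blast
      then show "x + y \<in> \<Union>C"
        using XY id by (meson UnionI is_idealD(2) subsetD)
    next
      fix r x assume "x \<in> \<Union>C"
      then show "r * x \<in> \<Union>C" using id is_idealD(3) by blast
    qed
    then show "\<Union>C \<in> Z" using C unfolding Z_def subset.chain_def by blast
  qed
  then obtain P where PZ: "P \<in> Z" "\<forall>X\<in>Z. P \<subseteq> X \<longrightarrow> X = P" by blast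
  have P: "is_ideal P" "I \<subseteq> P" "P \<inter> T = {}" using PZ(1) by (auto simp: Z_def)
  have max: "X = P" if "is_ideal X" "X \<inter> T = {}" "P \<subseteq> X" for X
    using PZ that P(2) by (auto simp: Z_def)
  have meet: "\<exists>p r. p \<in> P \<and> p + r * a \<in> T" if "a \<notin> P" for a
  proof -
    define X where "X = {p + r * a | p r. p \<in> P}"
    have "X \<inter> T \<noteq> {}"
      using max[of X] is_ideal_add_principal[OF P(1), of a] that unfolding X_def by blast
    then show ?thesis unfolding X_def by blast
  qed
  have "a \<in> P \<or> b \<in> P" if ab: "a * b \<in> P" for a b
  proof (rule ccontr)
    assume "\<not> ?thesis"
    then obtain p r q s where *: "p \<in> P" "q \<in> P" "p + r * a \<in> T" "q + s * b \<in> T" using meet by meson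
    have "(p + r * a) * (q + s * b) = p * (q + s * b) + (r * a) * q + (r * s) * (a * b)"
      by (simp add: algebra_simps)
    also have "\<dots> \<in> P"
      using is_idealD(4)[OF P(1) *(1)] is_idealD(3)[OF P(1) *(2)] is_idealD(3)[OF P(1) ab]
      by (intro is_idealD(2)[OF P(1)])
    finally show False using mult[OF *(3,4)] P(3) by blast
  qed
  moreover have "P \<noteq> UNIV" using P(3) one by blast
  ultimately have "prime_ideal P" using P(1) unfolding prime_ideal_def by blast
  then show thesis using that P(2,3) by blast
qed

text \<open>The elements \<open>b ^ N * (1 - b * x)\<close> form a submonoid containing b. If it
  missed the ideal of a, a prime P over a would miss it too. P is maximal since a is nonzero, and b
  is not in P, so b is invertible modulo P and some 1 - b r lies in P, although it belongs to the
  submonoid.\<close>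

lemma dedekind_power_stable:
  fixes a b :: "'a::idom"
  assumes D: "dedekind_domain TYPE('a)" and "a \<noteq> 0"
  shows "\<exists>N x r. b ^ N * (1 - b * x) = a * r"
proof (rule ccontr)
  assume neg: "\<not> ?thesis"
  define T where "T = {b ^ N * (1 - b * x) | N x. True}"
  have "x * y \<in> T" if "x \<in> T" "y \<in> T" for x y
  proof -
    obtain N s M t where xy: "x = b ^ N * (1 - b * s)" "y = b ^ M * (1 - b * t)"
      using \<open>x \<in> T\<close> \<open>y \<in> T\<close> unfolding T_def by blast
    \<comment> \<open>The last factor comes from (1 - b s)(1 - b t) = 1 - b (s + t - b s t).\<close>
    have "x * y = b ^ (N + M) * (1 - b * (s + t - b * s * t))"
      unfolding xy by (simp add: algebra_simps power_add)
    then show ?thesis unfolding T_def by blast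
  qed
  moreover have "1 \<in> T" unfolding T_def by (intro CollectI exI[of _ 0]) auto
  moreover have "range ((*) a) \<inter> T = {}" using neg unfolding T_def by (auto, metis)
  ultimately obtain P where P: "prime_ideal P" "range ((*) a) \<subseteq> P" "P \<inter> T = {}"
    using prime_ideal_disjoint_from_submonoid[OF is_ideal_principal, of T a] by blast
  have aP: "a \<in> P" using P(2) by (metis mult.right_neutral rangeI subsetD)
  then have "maximal_ideal P" using D P(1) \<open>a \<noteq> 0\<close> unfolding dedekind_domain_def by blast
  have idP: "is_ideal P" using P(1) unfolding prime_ideal_def by blast
  have "b \<in> T" unfolding T_def by (intro CollectI exI[of _ 1] exI[of _ 0]) auto
  then have "b \<notin> P" using P(3) by blast
  define X where "X = {p + r * b | p r. p \<in> P}"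
  have "X = UNIV"
    using \<open>maximal_ideal P\<close> \<open>b \<notin> P\<close> is_ideal_add_principal[OF idP, of b]
    unfolding maximal_ideal_def X_def by blast
  then obtain p r where "1 = p + r * b" "p \<in> P" unfolding X_def by blast
  then have "1 - b * r \<in> P" by (metis add_diff_cancel_right' mult.commute)
  moreover have "1 - b * r \<in> T" unfolding T_def by (intro CollectI exI[of _ 0] exI[of _ r]) auto
  ultimately show False using P(3) by blast
qed

text \<open>Let e be the product of factors 1 - g x over the generators g of J. Every generator is
  nilpotent on e modulo a, and e is nonzero modulo a because it is 1 modulo the proper ideal J,
  which contains a. Multiplying e by each generator as often as the result stays nonzero modulo a
  gives an element killed by all of J.\<close>

lemma exists_annihilated_by_proper_ideal:
  fixes J :: "'a::idom set"
  assumes D: "dedekind_domain TYPE('a)" and J: "is_ideal J" "1 \<notin> J" and a: "a \<in> J" "a \<noteq> 0"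
  shows "\<exists>c. \<not> a dvd c \<and> (\<forall>j\<in>J. a dvd c * j)"
proof -
  have "fin_gen_ideal J" using D J(1) unfolding dedekind_domain_def by blast
  then obtain F where F: "finite F" "F \<subseteq> J" and gen: "\<And>x. x \<in> J \<Longrightarrow> \<exists>r. x = (\<Sum>f\<in>F. r f * f)"
    using fin_gen_idealE[OF _ J(1)] by metis
  have "\<exists>e. 1 - e \<in> J \<and> (\<forall>f\<in>F. \<exists>N. a dvd e * f ^ N)"
    using F
  proof (induction F)
    case empty
    then show ?case using is_idealD(1)[OF J(1)] by (intro exI[of _ 1]) auto
  next
    case (insert g F)
    then obtain e where e: "1 - e \<in> J" "\<forall>f\<in>F. \<exists>N. a dvd e * f ^ N" by auto
    obtain M x r where M: "g ^ M * (1 - g * x) = a * r" using dedekind_power_stable[OF D a(2)] by blast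
    have "1 - e * (1 - g * x) = (1 - e) + (e * x) * g" by (simp add: algebra_simps)
    also have "\<dots> \<in> J" using e(1) insert.prems by (auto intro!: is_idealD(2,3)[OF J(1)])
    finally have "1 - e * (1 - g * x) \<in> J" .
    moreover have "\<exists>N. a dvd e * (1 - g * x) * f ^ N" if "f \<in> insert g F" for f
    proof (cases "f = g")
      case True
      have "e * (1 - g * x) * g ^ M = e * (g ^ M * (1 - g * x))" by (simp only: mult_ac)
      also have "a dvd \<dots>" unfolding M by simp
      finally show ?thesis using True by blast
    next
      case False
      with that e(2) obtain N where "a dvd e * f ^ N" by auto
      then have "a dvd (e * f ^ N) * (1 - g * x)" by (rule dvd_mult2)
      then show ?thesis by (auto simp: mult_ac intro!: exI[of _ N])
    qed
    ultimately show ?case by blast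
  qed
  then obtain e where e: "1 - e \<in> J" "\<And>f. f \<in> F \<Longrightarrow> \<exists>N. a dvd e * f ^ N" by blast
  have "\<not> a dvd e"
  proof
    assume "a dvd e"
    then obtain r where "e = a * r" by (rule dvdE)
    then have "e \<in> J" using is_idealD(4)[OF J(1) a(1)] by simp
    from is_idealD(2)[OF J(1) e(1) this] show False using J(2) by simp
  qed
  have "\<exists>c. \<not> a dvd c \<and> e dvd c \<and> (\<forall>f\<in>G. a dvd c * f)" if "finite G" "G \<subseteq> F" for G
    using that
  proof (induction G)
    case empty
    then show ?case using \<open>\<not> a dvd e\<close> by (intro exI[of _ e]) auto
  next
    case (insert g G)
    then obtain c where c: "\<not> a dvd c" "e dvd c" "\<forall>f\<in>G. a dvd c * f" by auto
    obtain N where "a dvd e * g ^ N" using e(2) insert.prems by blast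
    then have "a dvd c * g ^ N" using c(2) by (meson dvd_trans mult_dvd_mono dvd_refl)
    \<comment> \<open>One power below the first that kills c, the element is still nonzero modulo a.
      The induction keeps divisibility by e so that the next generator is nilpotent on the
      result.\<close>
    define k where "k = (LEAST k. a dvd c * g ^ k)"
    have k: "a dvd c * g ^ k" unfolding k_def by (rule LeastI) (rule \<open>a dvd c * g ^ N\<close>)
    with c(1) obtain m where m: "k = Suc m" by (cases k) auto
    have "\<not> a dvd c * g ^ m" using not_less_Least[of m "\<lambda>k. a dvd c * g ^ k"] m by (simp add: k_def)
    moreover have "e dvd c * g ^ m" using c(2) by simp
    moreover have "a dvd c * g ^ m * f" if "f \<in> insert g G" for f
    proof (cases "f = g")
      case True
      then show ?thesis using k m by (simp add: mult_ac)
    next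
      case False
      then have "a dvd (c * f) * g ^ m" using that c(3) by auto
      then show ?thesis by (simp add: mult_ac)
    qed
    ultimately show ?case by (intro exI[of _ "c * g ^ m"]) auto
  qed
  from this[OF F(1) subset_refl] obtain c where c: "\<not> a dvd c" "\<forall>f\<in>F. a dvd c * f" by blast
  have "a dvd c * j" if j: "j \<in> J" for j
  proof -
    obtain r where r: "j = (\<Sum>f\<in>F. r f * f)" using gen[OF j] by blast
    have "a dvd (\<Sum>f\<in>F. r f * (c * f))" using c(2) by (meson dvd_mult dvd_sum)
    also have "(\<Sum>f\<in>F. r f * (c * f)) = c * j" unfolding r sum_distrib_left by (simp only: mult_ac)
    finally show ?thesis .
  qed
  with c(1) show ?thesis by blast
qed

lemma to_fract_sum: "to_fract (sum f F) = (\<Sum>x\<in>F. to_fract (f x))"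
  by (induction F rule: infinite_finite_induct) auto

text \<open>The noetherian property replaces the determinant trick. All
  \<open>y ^ k * to_fract z\<close> stay in N, hence in the ring, so they lie in the finitely
  generated ideal L of ring elements of the form p(y) z. For k beyond the degrees of the polynomials
  that represent the generators, this gives a monic equation for y.\<close>

lemma stable_ideal_imp_in_ring:
  fixes y :: "'a::idom fract" and N :: "'a set"
  assumes D: "dedekind_domain TYPE('a)" and N: "is_ideal N" and z: "z \<in> N" "z \<noteq> 0"
    and stab: "\<And>x. x \<in> N \<Longrightarrow> \<exists>x'\<in>N. y * to_fract x = to_fract x'"
  shows "y \<in> range to_fract"
proof -
  define ev where "ev p = poly (fract_poly p) y * to_fract z" for p
  have ev_add: "ev (p + q) = ev p + ev q" and ev_smult: "ev (smult c p) = to_fract c * ev p" for p q c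
    by (simp_all add: ev_def algebra_simps)
  have ev_sum: "ev (sum f F) = (\<Sum>x\<in>F. ev (f x))" for f :: "'a \<Rightarrow> 'a poly" and F
    by (induction F rule: infinite_finite_induct) (auto simp: ev_add, auto simp: ev_def)
  define L where "L = {x. \<exists>p. to_fract x = ev p}"
  have L: "is_ideal L"
    unfolding is_ideal_def
  proof (intro conjI ballI allI impI)
    show "0 \<in> L" unfolding L_def by (auto simp: ev_def intro!: exI[of _ 0])
    fix x x' assume "x \<in> L" "x' \<in> L"
    then obtain p q where "to_fract x = ev p" "to_fract x' = ev q" unfolding L_def by blast
    then have "to_fract (x + x') = ev (p + q)" by (simp add: ev_add)
    then show "x + x' \<in> L" unfolding L_def by blast
  next
    fix r x assume "x \<in> L"
    then obtain p where "to_fract x = ev p" unfolding L_def by blast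
    then have "to_fract (r * x) = ev (smult r p)" by (simp add: ev_smult)
    then show "r * x \<in> L" unfolding L_def by blast
  qed
  then have "fin_gen_ideal L" using D unfolding dedekind_domain_def by blast
  then obtain F where F: "finite F" "F \<subseteq> L" and gen: "\<And>x. x \<in> L \<Longrightarrow> \<exists>r. x = (\<Sum>f\<in>F. r f * f)"
    using fin_gen_idealE[OF _ L] by metis
  have "\<forall>f\<in>F. \<exists>p. to_fract f = ev p" using F(2) unfolding L_def by blast
  then obtain p where p: "\<And>f. f \<in> F \<Longrightarrow> to_fract f = ev (p f)" by metis
  \<comment> \<open>Larger than the degree of every \<open>p f\<close>, so subtracting a combination
    of them from \<open>monom 1 d\<close> leaves it monic.\<close>
  define d where "d = Suc (\<Sum>f\<in>F. degree (p f))"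
  have "\<exists>x\<in>N. y ^ k * to_fract z = to_fract x" for k
  proof (induction k)
    case 0
    then show ?case using z by auto
  next
    case (Suc k)
    then show ?case using stab by (metis mult.assoc power_Suc)
  qed
  then obtain x where x: "y ^ d * to_fract z = to_fract x" by blast
  have "fract_poly (monom 1 d :: 'a poly) = monom 1 d" by (simp add: map_poly_monom)
  then have evd: "ev (monom 1 d) = to_fract x" by (simp add: ev_def poly_monom x)
  then have "x \<in> L" unfolding L_def by (metis (mono_tags) mem_Collect_eq)
  then obtain r where r: "x = (\<Sum>f\<in>F. r f * f)" using gen by blast
  define s where "s = (\<Sum>f\<in>F. smult (r f) (p f))"
  have evs: "ev s = to_fract x"
    unfolding s_def ev_sum r to_fract_sum by (intro sum.cong) (auto simp: ev_smult p)
  have "degree s \<le> d - 1"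
    unfolding s_def
  proof (rule degree_sum_le[OF F(1)])
    fix f assume "f \<in> F"
    then have "degree (p f) \<le> (\<Sum>f\<in>F. degree (p f))" using F(1) by (intro member_le_sum) auto
    then show "degree (smult (r f) (p f)) \<le> d - 1"
      using degree_smult_le[of "r f" "p f"] unfolding d_def by simp
  qed
  then have "degree s < d" unfolding d_def by simp
  define q where "q = monom 1 d + smult (-1) s"
  have cq: "coeff q d = 1" using coeff_eq_0[OF \<open>degree s < d\<close>] unfolding q_def by simp
  have "degree q \<le> d" unfolding q_def using \<open>degree s < d\<close>
    by (intro degree_add_le) (auto simp: degree_monom_le)
  with cq have "lead_coeff q = 1" by (metis le_antisym le_degree zero_neq_one)
  moreover have "ev q = 0" unfolding q_def ev_add ev_smult evd evs by simp
  then have "poly (fract_poly q) y = 0" using z(2) by (simp add: ev_def)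
  ultimately show ?thesis
    using D unfolding dedekind_domain_def to_fract_def[abs_def] by blast
qed

section \<open>Denominators, and the fractional ideal spanned by a vector\<close>

lemma base_ring_eq: "base_ring = range to_fract"
  by (simp add: base_ring_def to_fract_def[abs_def])

lemma base_ringI: "x = to_fract a \<Longrightarrow> x \<in> base_ring"
  by (simp add: base_ring_eq)

lemma loc_ring_eq: "loc_ring S = {to_fract a / to_fract s | a s. s \<in> S}"
  by (simp add: loc_ring_def Fract_conv_to_fract)

lemma loc_ring_common_denominator:
  fixes S :: "'a::idom set" and v :: "nat \<Rightarrow> 'a fract"
  assumes S: "1 \<in> S" "\<And>s t. s \<in> S \<Longrightarrow> t \<in> S \<Longrightarrow> s * t \<in> S" "0 \<notin> S"
    and v: "\<And>i. i < n \<Longrightarrow> v i \<in> loc_ring S"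
  shows "\<exists>s\<in>S. \<forall>i<n. to_fract s * v i \<in> base_ring"
  using v
proof (induction n)
  case 0
  then show ?case using S(1) by auto
next
  case (Suc n)
  then obtain s where s: "s \<in> S" "\<forall>i<n. to_fract s * v i \<in> base_ring" by auto
  obtain a t where t: "t \<in> S" "v n = to_fract a / to_fract t" using Suc.prems[of n] by (auto simp: loc_ring_eq)
  have "t \<noteq> 0" using t(1) S(3) by auto
  have "to_fract (s * t) * v i \<in> base_ring" if "i < Suc n" for i
  proof (cases "i = n")
    case True
    then have "to_fract (s * t) * v i = to_fract (s * a)" using t \<open>t \<noteq> 0\<close> by simp
    then show ?thesis by (rule base_ringI)
  next
    case False
    with that s(2) obtain b where "to_fract s * v i = to_fract b" by (auto simp: base_ring_eq less_Suc_eq)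
    then have "to_fract (s * t) * v i = to_fract (t * b)" by (simp add: mult_ac)
    then show ?thesis by (rule base_ringI)
  qed
  then show ?case using S(2)[OF s(1) t(1)] by blast
qed

text \<open>Makes the common denominator of an arbitrary vector over K an instance of the lemma
  above.\<close>

lemma loc_ring_nonzero: "loc_ring (- {0}) = (UNIV :: 'a::idom fract set)"
proof -
  have "x \<in> loc_ring (- {0})" for x :: "'a fract"
    by (cases x rule: Fract_cases) (auto simp: loc_ring_def)
  then show ?thesis by blast
qed

lemma common_denominator:
  fixes v :: "nat \<Rightarrow> 'a::idom fract"
  shows "\<exists>d. d \<noteq> 0 \<and> (\<forall>i<n. to_fract d * v i \<in> base_ring)"
  using loc_ring_common_denominator[of "- {0::'a}" n v] by (auto simp: loc_ring_nonzero)

text \<open>Writing \<open>C\<close> for the inverse of the fractional ideal \<open>I\<close> spanned by the \<open>v i\<close>: if \<open>I C\<close> were a proper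
  ideal, some \<open>y\<close> outside the ring would satisfy \<open>y I C \<subseteq> R\<close>, hence \<open>y C \<subseteq> C\<close>, making \<open>y\<close> integral.\<close>

lemma dedekind_vector_invertible:
  fixes v :: "nat \<Rightarrow> 'a::idom fract"
  assumes D: "dedekind_domain TYPE('a)" and i0: "i0 < n" "v i0 \<noteq> 0"
  shows "\<exists>y. (\<Sum>i<n. v i * y i) = 1 \<and> (\<forall>i<n. \<forall>j<n. y i * v j \<in> base_ring)"
proof -
  define C where "C = {c. \<forall>j<n. c * v j \<in> base_ring}"
  have C_add: "c + c' \<in> C" if "c \<in> C" "c' \<in> C" for c c'
  proof -
    have "(c + c') * v j \<in> base_ring" if j: "j < n" for j
    proof -
      obtain a b where "c * v j = to_fract a" "c' * v j = to_fract b"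
        using j \<open>c \<in> C\<close> \<open>c' \<in> C\<close> unfolding C_def base_ring_eq by blast
      then have "(c + c') * v j = to_fract (a + b)" by (simp add: distrib_right)
      then show ?thesis by (rule base_ringI)
    qed
    then show ?thesis by (simp add: C_def)
  qed
  have C_mult: "to_fract r * c \<in> C" if "c \<in> C" for c r
  proof -
    have "to_fract r * c * v j \<in> base_ring" if j: "j < n" for j
    proof -
      obtain a where "c * v j = to_fract a"
        using j \<open>c \<in> C\<close> unfolding C_def base_ring_eq by blast
      then have "to_fract r * c * v j = to_fract (r * a)" by (simp add: mult.assoc)
      then show ?thesis by (rule base_ringI)
    qed
    then show ?thesis by (simp add: C_def)
  qed
  have C_0: "0 \<in> C" by (auto simp: C_def base_ring_eq intro!: image_eqI[of _ _ 0])
  obtain d where d: "d \<noteq> 0" "to_fract d \<in> C" using common_denominator[of n v] by (auto simp: C_def)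
  define J where "J = {x. \<exists>y. (\<forall>i<n. y i \<in> C) \<and> to_fract x = (\<Sum>i<n. v i * y i)}"
  have J: "is_ideal J"
    unfolding is_ideal_def
  proof (intro conjI ballI allI impI)
    show "0 \<in> J" using C_0 unfolding J_def by (auto intro!: exI[of _ "\<lambda>_. 0"])
    fix x x' assume "x \<in> J" "x' \<in> J"
    then obtain y y' where "\<forall>i<n. y i \<in> C" "to_fract x = (\<Sum>i<n. v i * y i)"
      "\<forall>i<n. y' i \<in> C" "to_fract x' = (\<Sum>i<n. v i * y' i)" unfolding J_def by blast
    then show "x + x' \<in> J" unfolding J_def using C_add
      by (intro CollectI exI[of _ "\<lambda>i. y i + y' i"]) (auto simp: distrib_left sum.distrib)
  next
    fix r x assume "x \<in> J"
    then obtain y where "\<forall>i<n. y i \<in> C" "to_fract x = (\<Sum>i<n. v i * y i)" unfolding J_def by blast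
    then show "r * x \<in> J" unfolding J_def using C_mult
      by (intro CollectI exI[of _ "\<lambda>i. to_fract r * y i"])
        (auto simp: sum_distrib_left mult.left_commute)
  qed
  have single: "x \<in> J" if "to_fract x = v i * k" "i < n" "k \<in> C" for x i k
  proof -
    have "to_fract x = (\<Sum>j<n. v j * (if j = i then k else 0))"
      using that by (simp add: if_distrib cong: if_cong)
    then show ?thesis unfolding J_def using that C_0
      by (intro CollectI exI[of _ "\<lambda>j. if j = i then k else 0"]) auto
  qed
  have "1 \<in> J"
  proof (rule ccontr)
    assume "1 \<notin> J"
    obtain a where a: "to_fract d * v i0 = to_fract a" using d(2) i0(1) by (auto simp: C_def base_ring_eq)
    have "a \<noteq> 0" using a d(1) i0(2) by auto
    have "a \<in> J" using single[of a i0 "to_fract d"] a i0 d(2) by (simp add: mult.commute)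
    obtain c where c: "\<not> a dvd c" "\<And>j. j \<in> J \<Longrightarrow> a dvd c * j"
      using exists_annihilated_by_proper_ideal[OF D J \<open>1 \<notin> J\<close> \<open>a \<in> J\<close> \<open>a \<noteq> 0\<close>] by blast
    \<comment> \<open>As c kills J modulo a, this y maps J into the ring, yet it is not in the ring
      because a does not divide c.\<close>
    define y where "y = to_fract c / to_fract a"
    have yC: "y * k \<in> C" if k: "k \<in> C" for k
    proof -
      have "y * k * v j \<in> base_ring" if j: "j < n" for j
      proof -
        obtain x where x: "k * v j = to_fract x" using k j by (auto simp: C_def base_ring_eq)
        then have "x \<in> J" using single[of x j k] j k by (simp add: mult.commute)
        then obtain b where b: "c * x = a * b" using dvdE[OF c(2)] by blast
        have "y * k * v j = to_fract (c * x) / to_fract a" by (simp add: y_def mult.assoc x)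
        also have "\<dots> = to_fract b" unfolding b using \<open>a \<noteq> 0\<close> by simp
        finally show ?thesis by (rule base_ringI)
      qed
      then show ?thesis by (simp add: C_def)
    qed
    \<comment> \<open>The integrality argument wants an ideal of the ring, not the fractional ideal
      C. Multiplication by \<open>v i0\<close> carries C into the ring and commutes with y.\<close>
    define N where "N = {x. \<exists>k\<in>C. to_fract x = v i0 * k}"
    have "is_ideal N"
      unfolding is_ideal_def
    proof (intro conjI ballI allI impI)
      show "0 \<in> N" using C_0 unfolding N_def by (auto intro!: bexI[of _ 0])
      fix x x' assume "x \<in> N" "x' \<in> N"
      then obtain k k' where "k \<in> C" "k' \<in> C" "to_fract x = v i0 * k" "to_fract x' = v i0 * k'"
        unfolding N_def by blast
      then show "x + x' \<in> N" unfolding N_def using C_add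
        by (intro CollectI bexI[of _ "k + k'"]) (auto simp: distrib_left)
    next
      fix r x assume "x \<in> N"
      then obtain k where "k \<in> C" "to_fract x = v i0 * k" unfolding N_def by blast
      then show "r * x \<in> N" unfolding N_def using C_mult
        by (intro CollectI bexI[of _ "to_fract r * k"]) (auto simp: mult.left_commute)
    qed
    moreover have "a \<in> N" unfolding N_def using a d(2) by (intro CollectI bexI[of _ "to_fract d"]) (auto simp: mult.commute)
    moreover have "\<exists>x'\<in>N. y * to_fract x = to_fract x'" if "x \<in> N" for x
    proof -
      obtain k where k: "k \<in> C" "to_fract x = v i0 * k" using \<open>x \<in> N\<close> unfolding N_def by blast
      obtain x' where "y * k * v i0 = to_fract x'" using yC[OF k(1)] i0(1) by (auto simp: C_def base_ring_eq)
      then show ?thesis using yC[OF k(1)] k(2) unfolding N_def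
        by (intro bexI[of _ x'] CollectI bexI[of _ "y * k"]) (auto simp: mult_ac)
    qed
    ultimately have "y \<in> range to_fract" using stable_ideal_imp_in_ring[OF D] \<open>a \<noteq> 0\<close> by blast
    then obtain b where "to_fract c / to_fract a = to_fract b" unfolding y_def by blast
    then have "to_fract c = to_fract (a * b)" using \<open>a \<noteq> 0\<close> by (simp add: field_simps)
    then have "c = a * b" by (simp only: to_fract_eq_iff)
    then show False using c(1) by simp
  qed
  then obtain y where y: "\<forall>i<n. y i \<in> C" "to_fract (1::'a) = (\<Sum>i<n. v i * y i)" unfolding J_def by blast
  then show ?thesis by (intro exI[of _ y]) (auto simp: C_def)
qed

section \<open>Modules over a subring of a field with the whole field as fraction field\<close>

notation smult_vec (infixr "*s" 75)

global_interpretation KV: vector_space "smult_vec :: 'k::field \<Rightarrow> (nat \<Rightarrow> 'k) \<Rightarrow> (nat \<Rightarrow> 'k)"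
  by standard (auto simp: smult_vec_def fun_eq_iff algebra_simps)

lemma vector_space_mult: "vector_space ((*) :: 'k::field \<Rightarrow> 'k \<Rightarrow> 'k)"
  by standard (auto simp: algebra_simps)

lemma functional_extends:
  fixes f :: "(nat \<Rightarrow> 'k::field) \<Rightarrow> 'k"
  assumes "KV.independent B"
  obtains g where "Vector_Spaces.linear smult_vec (*) g" "\<And>b. b \<in> B \<Longrightarrow> g b = f b"
  using vector_space_pair.linear_independent_extend[OF vector_space_pair.intro[OF KV.vector_space_axioms vector_space_mult] assms, of f]
  by blast

lemma sum_lessThan_add:
  fixes f :: "nat \<Rightarrow> 'b::comm_monoid_add"
  shows "(\<Sum>i<m + k. f i) = (\<Sum>i<m. f i) + (\<Sum>i<k. f (m + i))"
  by (induction k) (auto simp: add.assoc)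

lemma sum_set_nth:
  assumes "distinct xs"
  shows "(\<Sum>b\<in>set xs. f b) = (\<Sum>i<length xs. f (xs ! i))"
  by (rule sum.reindex_bij_betw[symmetric], rule bij_betw_nth[OF assms]) auto

lemma sum_vec_apply: "(\<Sum>x\<in>F. f x) j = (\<Sum>x\<in>F. f x (j::nat))" for f :: "'b \<Rightarrow> nat \<Rightarrow> 'k::field"
  by (induction F rule: infinite_finite_induct) (auto simp: zero_fun_def)

lemma lincomb_eq_sum: "lincomb c vs = (\<Sum>i<length vs. c i *s (vs ! i))"
  by (auto simp: lincomb_def sum_vec_apply smult_vec_def)

lemma lincomb_distinct:
  assumes "distinct bs"
  shows "lincomb (\<lambda>i. u (bs ! i)) bs = (\<Sum>b\<in>set bs. u b *s b)"
  by (simp add: lincomb_eq_sum sum_set_nth[OF assms])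

text \<open>A maximal independent part of D still spans B, so it has at least \<open>card B\<close>
  elements and must be all of D. This yields independence of a new generating set by
  counting.\<close>

lemma independent_if_card_le_spanned:
  fixes B D :: "(nat \<Rightarrow> 'k::field) set"
  assumes "finite D" "KV.independent B" "card D \<le> card B" "B \<subseteq> KV.span D"
  shows "KV.independent D"
proof -
  obtain D' where D': "D' \<subseteq> D" "KV.independent D'" "D \<subseteq> KV.span D'"
    using KV.maximal_independent_subset[of D] by metis
  have "B \<subseteq> KV.span D'" using assms(4) D'(3) by (meson KV.span_minimal KV.subspace_span subset_trans)
  moreover have "finite D'" using D'(1) assms(1) finite_subset by blast
  ultimately have "card B \<le> card D'" using KV.independent_span_bound[OF _ assms(2)] by blast
  then have "D' = D" using assms(1,3) D'(1) by (intro card_seteq) auto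
  then show ?thesis using D'(2) by simp
qed

text \<open>Independence is asked over K. By clearing denominators it agrees with independence over
  A (\<open>lin_indep_iff\<close>), and it gives access to the dimension theory of vector
  spaces.\<close>

definition basis_of :: "'k::field set \<Rightarrow> (nat \<Rightarrow> 'k) set \<Rightarrow> (nat \<Rightarrow> 'k) set \<Rightarrow> bool" where
  "basis_of A M B \<longleftrightarrow> finite B \<and> KV.independent B \<and> M = span_in A B"

text \<open>Covers both R and R_S inside K; \<open>denominator\<close> says that K is the fraction
  field of A.\<close>

locale frac_subring =
  fixes A :: "'k::field set"
  assumes one_in: "1 \<in> A"
    and diff_in: "x \<in> A \<Longrightarrow> y \<in> A \<Longrightarrow> x - y \<in> A"
    and mult_in: "x \<in> A \<Longrightarrow> y \<in> A \<Longrightarrow> x * y \<in> A"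
    and denominator: "\<exists>a\<in>A. a \<noteq> 0 \<and> a * x \<in> A"
begin

lemma zero_in: "0 \<in> A" using diff_in[OF one_in one_in] by simp
lemma uminus_in: "x \<in> A \<Longrightarrow> - x \<in> A" using diff_in[OF zero_in, of x] by simp
lemma add_in: "x \<in> A \<Longrightarrow> y \<in> A \<Longrightarrow> x + y \<in> A" using diff_in[OF _ uminus_in, of x y] by simp
lemma power_in: "x \<in> A \<Longrightarrow> x ^ k \<in> A" by (induction k) (auto simp: one_in mult_in)
lemma sum_in: "(\<And>x. x \<in> F \<Longrightarrow> f x \<in> A) \<Longrightarrow> sum f F \<in> A"
  by (induction F rule: infinite_finite_induct) (auto simp: zero_in add_in)

lemmas ring_closed = zero_in one_in uminus_in add_in diff_in mult_in power_in

lemma submodD: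
  assumes "is_submod A M"
  shows "0 \<in> M" "x \<in> M \<Longrightarrow> y \<in> M \<Longrightarrow> x + y \<in> M" "c \<in> A \<Longrightarrow> x \<in> M \<Longrightarrow> c *s x \<in> M"
    "x \<in> M \<Longrightarrow> - x \<in> M" "x \<in> M \<Longrightarrow> y \<in> M \<Longrightarrow> x - y \<in> M"
proof -
  show *: "0 \<in> M" "\<And>x y. x \<in> M \<Longrightarrow> y \<in> M \<Longrightarrow> x + y \<in> M" "c \<in> A \<Longrightarrow> x \<in> M \<Longrightarrow> c *s x \<in> M" for c x
    using assms by (auto simp: is_submod_def)
  show neg: "\<And>x. x \<in> M \<Longrightarrow> - x \<in> M"
    using *(3)[OF uminus_in[OF one_in]] by simp
  show "x - y \<in> M" if "x \<in> M" "y \<in> M" using *(2)[OF that(1) neg[OF that(2)]] by simp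
qed

lemma submod_sum:
  assumes "is_submod A M" "\<And>x. x \<in> F \<Longrightarrow> f x \<in> M"
  shows "sum f F \<in> M"
  using assms(2) by (induction F rule: infinite_finite_induct) (auto intro: submodD[OF assms(1)])

lemma submod_Int: "is_submod A M \<Longrightarrow> is_submod A N \<Longrightarrow> is_submod A (M \<inter> N)"
  by (auto simp: is_submod_def)

lemma submod_subspace: "KV.subspace W \<Longrightarrow> is_submod A W"
  by (auto simp: is_submod_def KV.subspace_0 KV.subspace_add KV.subspace_scale)

lemma submod_add:
  assumes M: "is_submod A M" and N: "is_submod A N"
  shows "is_submod A {x + y | x y. x \<in> M \<and> y \<in> N}"
  unfolding is_submod_def
proof (intro conjI ballI)
  show "0 \<in> {x + y | x y. x \<in> M \<and> y \<in> N}"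
    using submodD(1)[OF M] submodD(1)[OF N] by (intro CollectI exI[of _ 0]) auto
  fix x y assume "x \<in> {x + y | x y. x \<in> M \<and> y \<in> N}" "y \<in> {x + y | x y. x \<in> M \<and> y \<in> N}"
  then obtain a b c d where "x = a + b" "y = c + d" "a \<in> M" "b \<in> N" "c \<in> M" "d \<in> N" by blast
  then show "x + y \<in> {x + y | x y. x \<in> M \<and> y \<in> N}"
    using submodD(2)[OF M] submodD(2)[OF N]
    by (intro CollectI exI[of _ "a + c"] exI[of _ "b + d"]) (auto simp: algebra_simps)
next
  fix c x assume "c \<in> A" "x \<in> {x + y | x y. x \<in> M \<and> y \<in> N}"
  then obtain a b where "x = a + b" "a \<in> M" "b \<in> N" by blast
  then show "c *s x \<in> {x + y | x y. x \<in> M \<and> y \<in> N}"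
    using submodD(3)[OF M \<open>c \<in> A\<close>] submodD(3)[OF N \<open>c \<in> A\<close>]
    by (intro CollectI exI[of _ "c *s a"] exI[of _ "c *s b"]) (auto simp: KV.scale_right_distrib)
qed

lemma span_in_least:
  assumes "is_submod A M" "X \<subseteq> M"
  shows "span_in A X \<subseteq> M"
proof
  fix x assume "x \<in> span_in A X"
  then obtain c vs where "x = lincomb c vs" "set vs \<subseteq> X" "\<forall>i<length vs. c i \<in> A"
    unfolding span_in_def by blast
  then show "x \<in> M" unfolding lincomb_eq_sum using assms(2)
    by (auto intro!: submod_sum[OF assms(1)] submodD(3)[OF assms(1)]) (meson nth_mem subsetD)
qed

lemma span_in_superset: "X \<subseteq> span_in A X"
proof
  fix x assume "x \<in> X"
  moreover have "x = lincomb (\<lambda>_. 1) [x]" by (simp add: lincomb_def)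
  ultimately show "x \<in> span_in A X" unfolding span_in_def using one_in
    by (intro CollectI exI[of _ "\<lambda>_. 1"] exI[of _ "[x]"]) auto
qed

lemma submod_span_in: "is_submod A (span_in A X)"
  unfolding is_submod_def
proof (intro conjI ballI)
  show "0 \<in> span_in A X" unfolding span_in_def
    by (intro CollectI exI[of _ "\<lambda>_. 0"] exI[of _ "[]"]) (auto simp: lincomb_eq_sum)
  fix x y assume "x \<in> span_in A X" "y \<in> span_in A X"
  then obtain c vs d ws where *: "x = lincomb c vs" "set vs \<subseteq> X" "\<forall>i<length vs. c i \<in> A"
    "y = lincomb d ws" "set ws \<subseteq> X" "\<forall>i<length ws. d i \<in> A" unfolding span_in_def by blast
  define e where "e i = (if i < length vs then c i else d (i - length vs))" for i
  have "x + y = lincomb e (vs @ ws)"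
    unfolding * lincomb_eq_sum length_append sum_lessThan_add
    by (intro arg_cong2[of _ _ _ _ "(+)"] sum.cong) (auto simp: e_def nth_append)
  moreover have "\<forall>i<length (vs @ ws). e i \<in> A" using * by (auto simp: e_def)
  ultimately show "x + y \<in> span_in A X" unfolding span_in_def using *
    by (intro CollectI exI[of _ e] exI[of _ "vs @ ws"]) auto
next
  fix a x assume "a \<in> A" "x \<in> span_in A X"
  then obtain c vs where *: "x = lincomb c vs" "set vs \<subseteq> X" "\<forall>i<length vs. c i \<in> A"
    unfolding span_in_def by blast
  have "a *s x = lincomb (\<lambda>i. a * c i) vs" unfolding * lincomb_eq_sum by (simp add: KV.scale_sum_right)
  then show "a *s x \<in> span_in A X" unfolding span_in_def using * \<open>a \<in> A\<close>
    by (intro CollectI exI[of _ "\<lambda>i. a * c i"] exI[of _ vs]) (auto simp: mult_in)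
qed

lemmas span_inD = submodD[OF submod_span_in]

lemma span_in_base: "x \<in> X \<Longrightarrow> x \<in> span_in A X" using span_in_superset by blast

lemma span_in_mono: "X \<subseteq> Y \<Longrightarrow> span_in A X \<subseteq> span_in A Y"
  by (rule span_in_least[OF submod_span_in]) (use span_in_superset in blast)

lemma span_in_subset_span: "span_in A X \<subseteq> KV.span X"
  by (rule span_in_least) (auto intro: submod_subspace KV.span_base)

lemma span_span_in: "KV.span (span_in A X) = KV.span X"
  by (metis KV.span_eq KV.span_superset span_in_subset_span span_in_superset subset_trans)

lemma span_in_finite:
  assumes "finite B"
  shows "span_in A B = {\<Sum>b\<in>B. c b *s b | c. \<forall>b\<in>B. c b \<in> A}"
proof (intro equalityI span_in_least)
  show "{\<Sum>b\<in>B. c b *s b | c. \<forall>b\<in>B. c b \<in> A} \<subseteq> span_in A B"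
    by (auto intro!: submod_sum[OF submod_span_in] span_inD(3) intro: span_in_base)
  show "is_submod A {\<Sum>b\<in>B. c b *s b | c. \<forall>b\<in>B. c b \<in> A}" (is "is_submod A ?S")
    unfolding is_submod_def
  proof (intro conjI ballI)
    show "0 \<in> ?S" using zero_in by (intro CollectI exI[of _ "\<lambda>_. 0"]) auto
    fix x y assume "x \<in> ?S" "y \<in> ?S"
    then obtain c d where "x = (\<Sum>b\<in>B. c b *s b)" "y = (\<Sum>b\<in>B. d b *s b)" "\<forall>b\<in>B. c b \<in> A" "\<forall>b\<in>B. d b \<in> A" by blast
    then show "x + y \<in> ?S"
      by (intro CollectI exI[of _ "\<lambda>b. c b + d b"]) (auto simp: add_in KV.scale_left_distrib sum.distrib)
  next
    fix a x assume "a \<in> A" "x \<in> ?S"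
    then obtain c where "x = (\<Sum>b\<in>B. c b *s b)" "\<forall>b\<in>B. c b \<in> A" by blast
    then show "a *s x \<in> ?S" using \<open>a \<in> A\<close>
      by (intro CollectI exI[of _ "\<lambda>b. a * c b"]) (auto simp: mult_in KV.scale_sum_right)
  qed
  show "B \<subseteq> ?S"
  proof
    fix x assume "x \<in> B"
    then have "x = (\<Sum>b\<in>B. (if b = x then 1 else 0) *s b)"
      using assms by (simp add: if_distrib[of "\<lambda>c. c *s _"] cong: if_cong)
    then show "x \<in> ?S" using zero_in one_in
      by (intro CollectI exI[of _ "\<lambda>b. if b = x then 1 else 0"]) auto
  qed
qed

lemma span_in_Un: "span_in A (X \<union> Y) = {x + y | x y. x \<in> span_in A X \<and> y \<in> span_in A Y}"
proof (intro equalityI span_in_least submod_add submod_span_in)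
  show "X \<union> Y \<subseteq> {x + y | x y. x \<in> span_in A X \<and> y \<in> span_in A Y}"
  proof
    fix z assume "z \<in> X \<union> Y"
    then show "z \<in> {x + y | x y. x \<in> span_in A X \<and> y \<in> span_in A Y}"
    proof
      assume "z \<in> X" then show ?thesis
        using span_in_base span_inD(1) by (intro CollectI exI[of _ z] exI[of _ 0]) auto
    next
      assume "z \<in> Y" then show ?thesis
        using span_in_base span_inD(1) by (intro CollectI exI[of _ 0] exI[of _ z]) auto
    qed
  qed
  show "{x + y | x y. x \<in> span_in A X \<and> y \<in> span_in A Y} \<subseteq> span_in A (X \<union> Y)"
    using span_in_mono[of X "X \<union> Y"] span_in_mono[of Y "X \<union> Y"] span_inD(2) by blast
qed

lemma span_in_single: "span_in A {b} = {c *s b | c. c \<in> A}"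
proof -
  have "(\<exists>c. x = c b *s b \<and> c b \<in> A) \<longleftrightarrow> (\<exists>c. x = c *s b \<and> c \<in> A)" for x
    by (auto intro: exI[of _ "\<lambda>_. _"])
  then show ?thesis by (auto simp: span_in_finite)
qed

lemma span_in_insert: "span_in A (insert b X) = {c *s b + x | c x. c \<in> A \<and> x \<in> span_in A X}"
  using span_in_Un[of "{b}" X] by (auto simp: span_in_single)

lemma span_clear_denominator:
  assumes N: "is_submod A N" and x: "x \<in> KV.span N"
  shows "\<exists>a\<in>A. a \<noteq> 0 \<and> a *s x \<in> N"
  using x
proof (induction rule: KV.span_induct_alt)
  case base
  then show ?case using submodD(1)[OF N] one_in by (intro bexI[of _ 1]) (auto simp: zero_fun_def)
next
  case (step c x y)
  then obtain a where a: "a \<in> A" "a \<noteq> 0" "a *s y \<in> N" by blast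
  obtain d where d: "d \<in> A" "d \<noteq> 0" "d * c \<in> A" using denominator by blast
  have "(a * d) *s (c *s x + y) = a *s ((d * c) *s x) + d *s (a *s y)"
    by (simp add: KV.scale_right_distrib mult_ac)
  also have "\<dots> \<in> N" using step.hyps
    by (intro submodD(2)[OF N submodD(3)[OF N a(1) submodD(3)[OF N d(3)]] submodD(3)[OF N d(1) a(3)]])
  finally show ?case using a d by (intro bexI[of _ "a * d"]) (auto simp: mult_in plus_fun_def)
qed

lemma finite_clear_denominator:
  assumes "finite B"
  shows "\<exists>a\<in>A. a \<noteq> 0 \<and> (\<forall>b\<in>B. a * u b \<in> A)"
  using assms
proof (induction B)
  case empty
  then show ?case using one_in by (intro bexI[of _ 1]) auto
next
  case (insert b B)
  then obtain a where a: "a \<in> A" "a \<noteq> 0" "\<forall>b\<in>B. a * u b \<in> A" by blast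
  obtain d where d: "d \<in> A" "d \<noteq> 0" "d * u b \<in> A" using denominator by blast
  have "a * d * u b \<in> A" using mult_in[OF a(1) d(3)] by (simp add: mult_ac)
  moreover have "a * d * u b' \<in> A" if "b' \<in> B" for b'
    using mult_in[OF d(1)] a(3) that by (metis mult.commute mult.assoc)
  ultimately show ?case using a d by (intro bexI[of _ "a * d"]) (auto simp: mult_in)
qed

lemma lin_indep_imp_distinct:
  assumes "lin_indep A bs"
  shows "distinct bs"
proof (rule ccontr)
  assume "\<not> distinct bs"
  then obtain i j where ij: "i < length bs" "j < length bs" "i \<noteq> j" "bs ! i = bs ! j"
    by (auto simp: distinct_conv_nth)
  define c :: "nat \<Rightarrow> 'k" where "c k = (if k = i then 1 else 0) - (if k = j then 1 else 0)" for k
  have "lincomb c bs = (\<Sum>k<length bs. (if k = i then bs ! k else 0)) - (\<Sum>k<length bs. (if k = j then bs ! k else 0))"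
    unfolding lincomb_eq_sum sum_subtractf[symmetric] by (intro sum.cong) (auto simp: c_def)
  also have "\<dots> = 0" using ij by simp
  finally have "lincomb c bs = 0" .
  moreover have "c k \<in> A" for k unfolding c_def using ring_closed by auto
  ultimately have "c i = 0" using assms ij(1) unfolding lin_indep_def by blast
  then show False using ij(3) by (simp add: c_def)
qed

lemma lin_indep_iff: "lin_indep A bs \<longleftrightarrow> distinct bs \<and> KV.independent (set bs)"
proof
  assume L: "lin_indep A bs"
  have d: "distinct bs" by (rule lin_indep_imp_distinct[OF L])
  moreover have "KV.independent (set bs)"
  proof
    assume "KV.dependent (set bs)"
    then obtain u v where u: "v \<in> set bs" "u v \<noteq> 0" "(\<Sum>b\<in>set bs. u b *s b) = 0"
      by (auto simp: KV.dependent_finite)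
    obtain a where a: "a \<in> A" "a \<noteq> 0" "\<forall>b\<in>set bs. a * u b \<in> A"
      using finite_clear_denominator[of "set bs" u] by auto
    have "lincomb (\<lambda>i. a * u (bs ! i)) bs = (\<Sum>b\<in>set bs. (a * u b) *s b)"
      by (rule lincomb_distinct[OF d, of "\<lambda>b. a * u b"])
    also have "\<dots> = a *s (\<Sum>b\<in>set bs. u b *s b)" by (simp add: KV.scale_sum_right)
    finally have "lincomb (\<lambda>i. a * u (bs ! i)) bs = 0" using u(3) by simp
    then have "\<forall>i<length bs. a * u (bs ! i) = 0" using L a(3) unfolding lin_indep_def by (meson nth_mem)
    then show False using u(1,2) a(2) by (auto simp: in_set_conv_nth)
  qed
  ultimately show "distinct bs \<and> KV.independent (set bs)" ..
next
  assume d: "distinct bs \<and> KV.independent (set bs)"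
  show "lin_indep A bs" unfolding lin_indep_def
  proof (intro allI impI)
    fix c i assume c: "(\<forall>i<length bs. c i \<in> A) \<and> lincomb c bs = 0" and i: "i < length bs"
    define u where "u b = c (the_inv_into {..<length bs} ((!) bs) b)" for b
    have u: "u (bs ! k) = c k" if "k < length bs" for k
      unfolding u_def using d that by (subst the_inv_into_f_f) (auto simp: inj_on_nth)
    have "(\<Sum>b\<in>set bs. u b *s b) = lincomb c bs"
      unfolding lincomb_distinct[OF conjunct1[OF d], symmetric] lincomb_eq_sum using u by simp
    then have "(\<Sum>b\<in>set bs. u b *s b) = 0" using c by simp
    then have "u (bs ! i) = 0" using d i
      by (intro KV.independentD[OF conjunct2[OF d] _ subset_refl]) auto
    then show "c i = 0" using u[OF i] by simp
  qed
qed

lemma lincomb_range_eq_span_in: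
  assumes "distinct bs"
  shows "{lincomb c bs | c. \<forall>i<length bs. c i \<in> A} = span_in A (set bs)"
proof (intro equalityI subsetI)
  fix x assume "x \<in> {lincomb c bs | c. \<forall>i<length bs. c i \<in> A}"
  then show "x \<in> span_in A (set bs)" unfolding span_in_def by blast
next
  fix x assume "x \<in> span_in A (set bs)"
  then obtain u where "x = (\<Sum>b\<in>set bs. u b *s b)" "\<forall>b\<in>set bs. u b \<in> A" by (auto simp: span_in_finite)
  then show "x \<in> {lincomb c bs | c. \<forall>i<length bs. c i \<in> A}"
    using lincomb_distinct[OF assms, of u] by (intro CollectI exI[of _ "\<lambda>i. u (bs ! i)"]) auto
qed

lemma free_mod_iff: "free_mod A M \<longleftrightarrow> (\<exists>B. basis_of A M B)"
proof
  assume "free_mod A M"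
  then obtain bs where bs: "lin_indep A bs" "M = {lincomb c bs | c. \<forall>i<length bs. c i \<in> A}"
    unfolding free_mod_def by blast
  then have "basis_of A M (set bs)" unfolding basis_of_def
    using lincomb_range_eq_span_in lin_indep_iff by auto
  then show "\<exists>B. basis_of A M B" ..
next
  assume "\<exists>B. basis_of A M B"
  then obtain B where B: "finite B" "KV.independent B" "M = span_in A B" unfolding basis_of_def by blast
  then obtain bs where bs: "set bs = B" "distinct bs" using finite_distinct_list by blast
  then have "lin_indep A bs" "M = {lincomb c bs | c. \<forall>i<length bs. c i \<in> A}" "set bs \<subseteq> M"
    using B lin_indep_iff lincomb_range_eq_span_in span_in_superset by auto
  then show "free_mod A M" unfolding free_mod_def by blast
qed

text \<open>\<open>free_quot\<close> speaks of lifts of a basis of N/M, and a basis of a complement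
  Q of M is such a system of lifts.\<close>

lemma free_quotI:
  assumes M: "is_submod A M" "M \<inter> Q = {0}" and N: "N = {x + y | x y. x \<in> M \<and> y \<in> Q}" and Q: "free_mod A Q"
  shows "free_quot A N M"
proof -
  obtain bs where bs: "set bs \<subseteq> Q" "lin_indep A bs" "Q = {lincomb c bs | c. \<forall>i<length bs. c i \<in> A}"
    using Q unfolding free_mod_def by blast
  have "set bs \<subseteq> N"
  proof
    fix b assume "b \<in> set bs"
    then show "b \<in> N" unfolding N using bs(1) submodD(1)[OF M(1)] by (intro CollectI exI[of _ 0] exI[of _ b]) auto
  qed
  moreover have "\<forall>c. (\<forall>i<length bs. c i \<in> A) \<and> lincomb c bs \<in> M \<longrightarrow> (\<forall>i<length bs. c i = 0)"
  proof (intro allI impI, elim conjE)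
    fix c i assume *: "\<forall>i<length bs. c i \<in> A" "lincomb c bs \<in> M" "i < length bs"
    then have "lincomb c bs \<in> M \<inter> Q" unfolding bs(3) by blast
    then show "c i = 0" using bs(2) M(2) * unfolding lin_indep_def by simp
  qed
  moreover have "N = {lincomb c bs + m | c m. (\<forall>i<length bs. c i \<in> A) \<and> m \<in> M}"
    unfolding N bs(3) by (auto simp: add.commute)
  ultimately show ?thesis unfolding free_quot_def by blast
qed

end

section \<open>Cancellation of free summands\<close>

text \<open>The assumption says that A/(a) has dimension at most zero for nonzero a. It is all that
  cancellation uses of the Dedekind property.\<close>

locale stable_subring = frac_subring +
  assumes power_stable: "a \<in> A \<Longrightarrow> a \<noteq> 0 \<Longrightarrow> b \<in> A \<Longrightarrow> \<exists>N. \<exists>x\<in>A. \<exists>r\<in>A. b ^ N * (1 - b * x) = a * r"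
begin

text \<open>In \<open>A / a\<close> the element \<open>b\<close> is a unit on one factor, where \<open>1 - b x\<close> vanishes, and nilpotent on the
  complementary one, where \<open>1 - b x\<close> and \<open>e\<close> are units; so \<open>b + (1 - b x) e\<close> is a unit.\<close>

lemma stable_range:
  assumes A: "a \<in> A" "b \<in> A" "c0 \<in> A" "c1 \<in> A" "e \<in> A" and "a \<noteq> 0" and one: "a * c0 + b * c1 + e = 1"
  shows "\<exists>d\<in>A. \<exists>s\<in>A. \<exists>t\<in>A. s * a + t * (b + d * e) = 1"
proof -
  obtain N x r where x: "x \<in> A" "r \<in> A" "b ^ N * (1 - b * x) = a * r"
    using power_stable[OF A(1) \<open>a \<noteq> 0\<close> A(2)] by blast
  define u where "u = b + (1 - b * x) * e"
  \<comment> \<open>Inserting e = 1 - a c0 - b c1 into u shows that u is 1 modulo a and b; y and f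
    collect the multiples of b and a, so that 1 = y b + u + f a.\<close>
  define y where "y = x + c1 - b * x * c1 - 1"
  define f where "f = (1 - b * x) * c0"
  have yf: "y \<in> A" "f \<in> A" "u \<in> A" unfolding y_def f_def u_def using A x by (auto intro!: ring_closed)
  have e: "e = 1 - a * c0 - b * c1" using one by (simp add: algebra_simps)
  have 1: "1 = y * b + u + f * a" unfolding y_def f_def u_def e by (simp add: algebra_simps)
  \<comment> \<open>Elements that generate the unit ideal still do so after b is replaced by a
    power. For k = N + 1 that power can be removed, as it equals \<open>b ^ N * u\<close> modulo
    a.\<close>
  have "\<exists>p\<in>A. \<exists>q\<in>A. \<exists>w\<in>A. 1 = p * b ^ k + q * u + w * a" for k
  proof (induction k)
    case 0
    then show ?case using one_in zero_in by (intro bexI[of _ 1] bexI[of _ 0]) auto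
  next
    case (Suc k)
    then obtain p q w where pqw: "p \<in> A" "q \<in> A" "w \<in> A" "1 = p * b ^ k + q * u + w * a" by blast
    note pqw(4)
    also have "p * b ^ k + q * u + w * a = p * b ^ k * (y * b + u + f * a) + q * u + w * a"
      using 1 by simp
    also have "\<dots> = (p * y) * b ^ Suc k + (p * b ^ k + q) * u + (p * b ^ k * f + w) * a"
      by (simp add: algebra_simps)
    finally have "1 = (p * y) * b ^ Suc k + (p * b ^ k + q) * u + (p * b ^ k * f + w) * a" .
    moreover have "p * y \<in> A" "p * b ^ k + q \<in> A" "p * b ^ k * f + w \<in> A"
      using pqw yf A by (auto intro!: ring_closed)
    ultimately show ?case by blast
  qed
  then obtain p q w where pqw: "p \<in> A" "q \<in> A" "w \<in> A" "1 = p * b ^ Suc N + q * u + w * a" by blast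
  have "b ^ N * u = b ^ Suc N + (b ^ N * (1 - b * x)) * e" unfolding u_def by (simp add: algebra_simps)
  then have "b ^ Suc N = b ^ N * u - a * r * e" unfolding x(3) by simp
  then have "1 = p * (b ^ N * u - a * r * e) + q * u + w * a" using pqw(4) by simp
  also have "\<dots> = (w - p * r * e) * a + (p * b ^ N + q) * u" by (simp add: algebra_simps)
  finally have "(w - p * r * e) * a + (p * b ^ N + q) * (b + (1 - b * x) * e) = 1" unfolding u_def by simp
  moreover have "1 - b * x \<in> A" "w - p * r * e \<in> A" "p * b ^ N + q \<in> A"
    using pqw A x by (auto intro!: ring_closed)
  ultimately show ?thesis by blast
qed

text \<open>The values of \<open>\<phi>\<close> on B generate the unit ideal. Stable range allows a
  change of basis after which two of these values already do; a further unimodular change turns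
  these two vectors into u with value 1 and v with value 0. Subtracting multiples of u from the
  remaining basis vectors moves them into the kernel, and together with v they form a basis of
  it.\<close>

lemma kernel_of_split_functional_free:
  assumes B: "finite B" "KV.independent B"
    and add: "\<And>x y. \<phi> (x + y) = \<phi> x + \<phi> y" and scale: "\<And>c x. \<phi> (c *s x) = c * \<phi> x"
    and \<phi>B: "\<And>b. b \<in> B \<Longrightarrow> \<phi> b \<in> A" and m: "m \<in> span_in A B" "\<phi> m = 1"
  shows "\<exists>D. basis_of A {x \<in> span_in A B. \<phi> x = 0} D"
proof -
  have diff: "\<phi> (x - y) = \<phi> x - \<phi> y" for x y using add[of "x - y" y] by simp
  have zero: "\<phi> 0 = 0" using scale[of 0 0] by simp
  have ker: "is_submod A {x. \<phi> x = 0}" by (auto simp: is_submod_def add scale zero)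
  have "is_submod A {x. \<phi> x \<in> A}" by (auto simp: is_submod_def add scale zero ring_closed)
  then have \<phi>A: "\<phi> x \<in> A" if "x \<in> span_in A B" for x
    using span_in_least[of "{x. \<phi> x \<in> A}" B] \<phi>B that by blast
  \<comment> \<open>Stable range needs a nonzero first entry.\<close>
  have "\<exists>b\<in>B. \<phi> b \<noteq> 0"
    using span_in_least[OF ker, of B] m by fastforce
  then obtain b0 where b0: "b0 \<in> B" "\<phi> b0 \<noteq> 0" by blast
  show ?thesis
  proof (cases "B = {b0}")
    case True
    \<comment> \<open>With one basis vector there is no partner for a change of basis, but then the
      kernel is zero.\<close>
    have "{x \<in> span_in A B. \<phi> x = 0} = {0}"
      unfolding True using b0(2) zero zero_in by (auto simp: span_in_single scale intro!: exI[of _ 0])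
    then have "basis_of A {x \<in> span_in A B. \<phi> x = 0} {}"
      unfolding basis_of_def using KV.independent_empty by (auto simp: span_in_finite)
    then show ?thesis by blast
  next
    case False
    then obtain b1 where b1: "b1 \<in> B" "b1 \<noteq> b0" using b0(1) by blast
    define C where "C = B - {b0, b1}"
    have BC: "B = insert b0 (insert b1 C)" unfolding C_def using b0 b1 by blast
    have cardB: "card B = 2 + card C" using B(1) b0 b1 unfolding BC by (simp add: C_def)
    obtain c0 c1 w where c: "c0 \<in> A" "c1 \<in> A" "w \<in> span_in A C" "m = c0 *s b0 + (c1 *s b1 + w)"
      using m(1) unfolding BC span_in_insert by blast
    have CB: "span_in A C \<subseteq> span_in A B" by (rule span_in_mono) (auto simp: BC)
    \<comment> \<open>All basis vectors other than b0 and b1 are bundled into w, so stable range is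
      only needed for three terms, with \<open>\<phi> w\<close> in the role of e.\<close>
    have "\<phi> b0 * c0 + \<phi> b1 * c1 + \<phi> w = 1" using m(2) unfolding c(4) add scale by (simp add: algebra_simps)
    then obtain d s t where dst: "d \<in> A" "s \<in> A" "t \<in> A" "s * \<phi> b0 + t * (\<phi> b1 + d * \<phi> w) = 1"
      using stable_range[of "\<phi> b0" "\<phi> b1" c0 c1 "\<phi> w"] b0 b1 \<phi>B c \<phi>A CB by blast
    define b1' where "b1' = b1 + d *s w"
    \<comment> \<open>The passage from (b0, b1') to (u, v) has determinant -(s
      \<open>\<phi> b0\<close> + t \<open>\<phi> b1'\<close>) = -1, so b0 and b1' can be recovered
      from u and v over A.\<close>
    define u where "u = s *s b0 + t *s b1'"
    define v where "v = \<phi> b1' *s b0 - \<phi> b0 *s b1'"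
    define D where "D = insert v ((\<lambda>z. z - \<phi> z *s u) ` C)"
    have \<phi>u: "\<phi> u = 1" unfolding u_def b1'_def add scale using dst(4) by simp
    have \<phi>v: "\<phi> v = 0" unfolding v_def diff scale by simp
    have inF: "b0 \<in> span_in A B" "b1 \<in> span_in A B" "w \<in> span_in A B"
      using b0 b1 c CB span_in_base by auto
    then have b1': "b1' \<in> span_in A B" unfolding b1'_def using dst by (auto intro!: span_inD(2,3))
    then have uF: "u \<in> span_in A B" unfolding u_def using dst inF by (auto intro!: span_inD(2,3))
    have vF: "v \<in> span_in A B" unfolding v_def using b1' inF \<phi>A by (auto intro!: span_inD(3,5))
    have DF: "D \<subseteq> {x \<in> span_in A B. \<phi> x = 0}"
    proof
      fix x assume "x \<in> D"
      then consider "x = v" | z where "z \<in> C" "x = z - \<phi> z *s u" unfolding D_def by blast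
      then show "x \<in> {x \<in> span_in A B. \<phi> x = 0}"
      proof cases
        case 1
        then show ?thesis using vF \<phi>v by simp
      next
        case 2
        then have "z \<in> span_in A B" using CB span_in_base by blast
        with 2 show ?thesis using uF \<phi>A by (auto intro!: span_inD(3,5) simp: diff scale \<phi>u)
      qed
    qed
    define G where "G = span_in A (insert u D)"
    note G = submodD[OF submod_span_in[of "insert u D"], folded G_def]
    have uG: "u \<in> G" and vG: "v \<in> G" unfolding G_def D_def by (auto intro: span_in_base)
    have "z \<in> G" if "z \<in> C" for z
    proof -
      have "z - \<phi> z *s u \<in> G" unfolding G_def D_def using that by (intro span_in_base) auto
      moreover have "\<phi> z *s u \<in> G" using that \<phi>B uG BC by (intro G(3)) auto
      ultimately have "(z - \<phi> z *s u) + \<phi> z *s u \<in> G" by (rule G(2))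
      then show ?thesis by simp
    qed
    then have "C \<subseteq> G" by blast
    then have wG: "w \<in> G" using span_in_least[OF submod_span_in, of C] c(3) unfolding G_def by blast
    have sv: "s * \<phi> b0 + t * \<phi> b1' = 1" using \<phi>u unfolding u_def add scale .
    have "\<phi> b0 *s u + t *s v = (s * \<phi> b0 + t * \<phi> b1') *s b0"
      unfolding u_def v_def by (simp add: KV.scale_right_distrib KV.scale_right_diff_distrib KV.scale_left_distrib mult_ac)
    then have "\<phi> b0 *s u + t *s v = b0" unfolding sv by simp
    moreover have "\<phi> b0 *s u + t *s v \<in> G" using uG vG \<phi>A[OF inF(1)] dst(3) G(2,3) by blast
    ultimately have b0G: "b0 \<in> G" by simp
    have "\<phi> b1' *s u - s *s v = (s * \<phi> b0 + t * \<phi> b1') *s b1'"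
      unfolding u_def v_def by (simp add: KV.scale_right_distrib KV.scale_right_diff_distrib KV.scale_left_distrib mult_ac)
    then have "\<phi> b1' *s u - s *s v = b1'" unfolding sv by simp
    moreover have "\<phi> b1' *s u - s *s v \<in> G" using uG vG \<phi>A[OF b1'] dst(2) G(3,5) by blast
    ultimately have "b1' \<in> G" by simp
    then have "b1' - d *s w \<in> G" using wG dst(1) G(3,5) by blast
    then have "b1 \<in> G" unfolding b1'_def by simp
    then have BG: "B \<subseteq> G" using b0G \<open>C \<subseteq> G\<close> unfolding BC by blast
    have fin: "finite (insert u D)" unfolding D_def C_def using B(1) by simp
    \<comment> \<open>The new vectors generate all of B and are no more numerous than B, which
      forces independence.\<close>
    have "card (insert u D) \<le> 2 + card ((\<lambda>z. z - \<phi> z *s u) ` C)"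
      unfolding D_def using B(1) by (simp add: C_def card_insert_if)
    also have "\<dots> \<le> card B" unfolding cardB using card_image_le[of C] B(1) by (simp add: C_def)
    finally have "KV.independent (insert u D)"
      using independent_if_card_le_spanned[OF fin B(2)] BG span_in_subset_span unfolding G_def by blast
    then have ind: "KV.independent D" by (rule KV.independent_mono) blast
    have "is_submod A {x \<in> span_in A B. \<phi> x = 0}"
      using submod_Int[OF submod_span_in ker, of B] by (simp add: Collect_conj_eq)
    from span_in_least[OF this DF] have "span_in A D \<subseteq> {x \<in> span_in A B. \<phi> x = 0}" .
    moreover have "x \<in> span_in A D" if x: "x \<in> span_in A B" "\<phi> x = 0" for x
    proof -
      have "x \<in> G" using x(1) BG span_in_least[OF submod_span_in, of B] unfolding G_def by blast
      then obtain c y where y: "x = c *s u + y" "y \<in> span_in A D" unfolding G_def span_in_insert by blast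
      then have "\<phi> y = 0" using \<open>span_in A D \<subseteq> _\<close> by blast
      then have "c = 0" using x(2) unfolding y(1) add scale \<phi>u by simp
      then show ?thesis using y by simp
    qed
    ultimately have "{x \<in> span_in A B. \<phi> x = 0} = span_in A D" by blast
    then have "basis_of A {x \<in> span_in A B. \<phi> x = 0} D" unfolding basis_of_def using fin ind by auto
    then show ?thesis by blast
  qed
qed

text \<open>As m lies outside the K-span of N, some K-linear functional vanishes on N and is 1 at m.
  On F it reads off the coefficient of m, so N is the kernel of a split functional on a free
  module.\<close>

lemma cancel_rank_one:
  assumes B: "basis_of A F B" and N: "is_submod A N" and F: "F = {x + c *s m | x c. x \<in> N \<and> c \<in> A}"
    and m: "m \<notin> KV.span N"
  shows "\<exists>D. basis_of A N D"
proof -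
  obtain N0 where N0: "N0 \<subseteq> N" "KV.independent N0" "N \<subseteq> KV.span N0"
    using KV.maximal_independent_subset[of N] by metis
  have "KV.span N0 = KV.span N" using N0 by (meson KV.span_eq KV.span_superset subset_trans)
  then have "m \<notin> KV.span N0" using m by simp
  then have "KV.independent (insert m N0)" using N0(2) by (intro KV.independent_insertI)
  then obtain \<phi> where lin: "Vector_Spaces.linear smult_vec (*) \<phi>"
    and \<phi>: "\<And>b. b \<in> insert m N0 \<Longrightarrow> \<phi> b = (if b = m then 1 else 0)"
    using functional_extends[of "insert m N0" "\<lambda>b. if b = m then 1 else 0"] by blast
  have add: "\<phi> (x + y) = \<phi> x + \<phi> y" and scale: "\<phi> (c *s x) = c * \<phi> x" for x y c
    using lin by (auto simp: Vector_Spaces.linear_iff)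
  have "KV.subspace {x. \<phi> x = 0}" using scale[of 0 0] by (auto simp: KV.subspace_def add scale)
  moreover have "m \<notin> N0" using \<open>m \<notin> KV.span N0\<close> KV.span_base by blast
  then have "N0 \<subseteq> {x. \<phi> x = 0}" using \<phi> by auto
  ultimately have \<phi>N: "\<phi> x = 0" if "x \<in> N" for x
    using KV.span_minimal[of N0 "{x. \<phi> x = 0}"] N0(3) that by blast
  have \<phi>F: "\<phi> (x + c *s m) = c" if "x \<in> N" for x c
    using \<phi>N[OF that] \<phi>[of m] by (simp add: add scale)
  have FB: "F = span_in A B" "finite B" "KV.independent B" using B by (auto simp: basis_of_def)
  have "b \<in> B \<Longrightarrow> \<phi> b \<in> A" for b using span_in_base[of b B] \<phi>F unfolding FB(1)[symmetric] F by auto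
  moreover have "m \<in> span_in A B" unfolding FB(1)[symmetric] F
    using submodD(1)[OF N] one_in by (intro CollectI exI[of _ 0] exI[of _ 1]) auto
  ultimately have "\<exists>D. basis_of A {x \<in> span_in A B. \<phi> x = 0} D"
    using \<phi>[of m] by (intro kernel_of_split_functional_free FB add scale) auto
  moreover have "{x \<in> span_in A B. \<phi> x = 0} = N"
  proof (intro equalityI subsetI)
    fix x assume "x \<in> {x \<in> span_in A B. \<phi> x = 0}"
    then have "x \<in> F" "\<phi> x = 0" using FB(1) by auto
    then obtain y c where yc: "x = y + c *s m" "y \<in> N" unfolding F by blast
    then have "c = 0" using \<phi>F \<open>\<phi> x = 0\<close> by simp
    then show "x \<in> N" using yc by simp
  next
    fix x assume x: "x \<in> N"
    then have "x \<in> F" unfolding F using zero_in by (intro CollectI exI[of _ x] exI[of _ 0]) auto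
    then show "x \<in> {x \<in> span_in A B. \<phi> x = 0}" using \<phi>N[OF x] FB(1) by simp
  qed
  ultimately show ?thesis by simp
qed

text \<open>Induction over the basis of M. One basis vector m is moved to the other side: N' = N + A
  m is free by the induction hypothesis, having the span of the other basis vectors as a complement
  in F. Then m is cancelled from N'.\<close>

lemma cancel_free_summand:
  assumes B: "basis_of A F B" and C: "basis_of A M C" and N: "is_submod A N"
    and F: "F = {x + y | x y. x \<in> N \<and> y \<in> M}" and NM: "N \<inter> M = {0}"
  shows "\<exists>D. basis_of A N D"
proof -
  have "finite C" "KV.independent C" "M = span_in A C" using C by (auto simp: basis_of_def)
  then show ?thesis using F NM N
  proof (induction C arbitrary: M N)
    case empty
    then have "F = N" by (auto simp: span_in_finite)
    then show ?case using B by blast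
  next
    case (insert m C)
    have ind: "KV.independent C" and mC: "m \<notin> KV.span C"
      using insert.prems(1) insert.hyps by (auto simp: KV.independent_insert)
    define N' where "N' = {x + c *s m | x c. x \<in> N \<and> c \<in> A}"
    have N'eq: "N' = {x + y | x y. x \<in> N \<and> y \<in> span_in A {m}}" unfolding N'_def span_in_single by blast
    have N': "is_submod A N'" unfolding N'eq by (rule submod_add[OF insert.prems(5) submod_span_in])
    have cm: "c *s m \<in> M" if "c \<in> A" for c
      unfolding insert.prems(2) using that by (intro span_inD(3) span_in_base) auto
    have CM: "span_in A C \<subseteq> M" unfolding insert.prems(2) by (rule span_in_mono) blast
    have M: "is_submod A M" unfolding insert.prems(2) by (rule submod_span_in)
    have "F = {x + y | x y. x \<in> N' \<and> y \<in> span_in A C}"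
      unfolding insert.prems(3) insert.prems(2) span_in_insert N'_def
      by (auto, metis add.assoc, metis add.assoc)
    moreover have "N' \<inter> span_in A C = {0}"
    proof (intro equalityI subsetI)
      fix y assume "y \<in> N' \<inter> span_in A C"
      then obtain x c where y: "y = x + c *s m" "x \<in> N" "c \<in> A" "y \<in> span_in A C" unfolding N'_def by blast
      have "y - c *s m \<in> M" using y(4) CM cm[OF y(3)] by (intro submodD(5)[OF M]) auto
      then have "x \<in> N \<inter> M" using y(1,2) by simp
      then have "x = 0" using insert.prems(4) by blast
      have "c = 0"
      proof (rule ccontr)
        assume "c \<noteq> 0"
        have "c *s m \<in> KV.span C" using y \<open>x = 0\<close> span_in_subset_span by auto
        then have "inverse c *s (c *s m) \<in> KV.span C" by (rule KV.span_scale)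
        then show False using mC \<open>c \<noteq> 0\<close> by simp
      qed
      then show "y \<in> {0}" using y \<open>x = 0\<close> by simp
    next
      fix y :: "nat \<Rightarrow> 'a" assume "y \<in> {0}"
      then show "y \<in> N' \<inter> span_in A C" using submodD(1)[OF N'] span_inD(1) by simp
    qed
    ultimately obtain B' where B': "basis_of A N' B'" using insert.IH[OF ind refl _ _ N'] by blast
    have "m \<notin> KV.span N"
    proof
      assume "m \<in> KV.span N"
      then obtain a where a: "a \<in> A" "a \<noteq> 0" "a *s m \<in> N"
        using span_clear_denominator[OF insert.prems(5)] by blast
      then have "a *s m = 0" using cm[OF a(1)] insert.prems(4) by blast
      then show False using a(2) mC KV.span_zero by auto
    qed
    then show ?case using cancel_rank_one[OF B' insert.prems(5) N'_def] by blast
  qed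
qed

end

section \<open>Direct summands of standard modules\<close>

definition unit_vec :: "nat \<Rightarrow> nat \<Rightarrow> 'k::field" where
  "unit_vec i = (\<lambda>j. if j = i then 1 else 0)"

lemma inj_unit_vec: "inj_on (unit_vec :: nat \<Rightarrow> nat \<Rightarrow> 'k::field) I"
  by (rule inj_onI) (metis unit_vec_def zero_neq_one)

lemma sum_unit_vec:
  fixes u :: "nat \<Rightarrow> 'k::field"
  assumes "finite I"
  shows "(\<Sum>i\<in>I. u i *s unit_vec i) = (\<lambda>j. if j \<in> I then u j else 0)"
  using assms by (auto simp: fun_eq_iff sum_vec_apply smult_vec_def unit_vec_def if_distrib cong: if_cong)

lemma independent_unit_vec:
  assumes "finite I"
  shows "KV.independent (unit_vec ` I :: (nat \<Rightarrow> 'k::field) set)"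
proof
  assume "KV.dependent (unit_vec ` I :: (nat \<Rightarrow> 'k) set)"
  then obtain u and v :: "nat \<Rightarrow> 'k" where u: "v \<in> unit_vec ` I" "u v \<noteq> 0" "(\<Sum>b\<in>unit_vec ` I. u b *s b) = 0"
    using KV.dependent_finite[of "unit_vec ` I"] assms by blast
  from u(3) have "(\<Sum>i\<in>I. u (unit_vec i) *s unit_vec i) = 0" by (simp add: sum.reindex[OF inj_unit_vec])
  then have "(\<lambda>j. if j \<in> I then u (unit_vec j) else 0) = 0" by (simp only: sum_unit_vec[OF assms])
  then have "(if j \<in> I then u (unit_vec j) else 0) = 0" for j by (auto dest: fun_cong[where x = j])
  then have "\<And>j. j \<in> I \<Longrightarrow> u (unit_vec j) = 0" by presburger
  then show False using u(1,2) by blast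
qed

lemma subspace_std_mod: "KV.subspace (std_mod UNIV n)"
  by (auto simp: KV.subspace_def std_mod_def smult_vec_def)

lemma span_subset_std_mod:
  assumes "X \<subseteq> std_mod A n"
  shows "KV.span X \<subseteq> std_mod UNIV n"
  using assms by (intro KV.span_minimal subspace_std_mod) (auto simp: std_mod_def)

text \<open>Applied to the bases of two nested free modules: equal rank forces equal K-span.\<close>

lemma spanned_if_card_le:
  fixes B :: "(nat \<Rightarrow> 'k::field) set"
  assumes "KV.independent B" "finite B'" "B \<subseteq> KV.span B'" "card B' \<le> card B"
  shows "B' \<subseteq> KV.span B"
proof (rule ccontr)
  assume "\<not> ?thesis"
  then obtain x where x: "x \<in> B'" "x \<notin> KV.span B" by blast
  have "KV.independent (insert x B)" using assms(1) x(2) by (rule KV.independent_insertI[rotated])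
  moreover have "insert x B \<subseteq> KV.span B'" using assms(3) x(1) KV.span_base by blast
  ultimately have "finite (insert x B) \<and> card (insert x B) \<le> card B'"
    by (rule KV.independent_span_bound[OF assms(2)])
  moreover have "x \<notin> B" using x(2) KV.span_base by blast
  ultimately show False using assms(4) by auto
qed

context frac_subring
begin

text \<open>General index sets are needed because the free part of \<open>dsum_std\<close> occupies
  the coordinates n, ..., n + a - 1.\<close>

lemma basis_of_coordinate_module:
  assumes I: "finite I"
  shows "basis_of A {v. (\<forall>i\<in>I. v i \<in> A) \<and> (\<forall>i. i \<notin> I \<longrightarrow> v i = 0)} (unit_vec ` I)"
proof -
  let ?e = "unit_vec :: nat \<Rightarrow> nat \<Rightarrow> 'k"
  have "span_in A (?e ` I) = {\<Sum>i\<in>I. c (?e i) *s ?e i | c. \<forall>i\<in>I. c (?e i) \<in> A}"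
    using I by (simp add: span_in_finite sum.reindex[OF inj_unit_vec])
  also have "\<dots> = {\<lambda>j. if j \<in> I then c (?e j) else 0 | c. \<forall>i\<in>I. c (?e i) \<in> A}"
    by (simp only: sum_unit_vec[OF I])
  also have "\<dots> = {v. (\<forall>i\<in>I. v i \<in> A) \<and> (\<forall>i. i \<notin> I \<longrightarrow> v i = 0)}"
  proof (intro equalityI subsetI)
    fix v assume "v \<in> {v. (\<forall>i\<in>I. v i \<in> A) \<and> (\<forall>i. i \<notin> I \<longrightarrow> v i = 0)}"
    then show "v \<in> {\<lambda>j. if j \<in> I then c (?e j) else 0 | c. \<forall>i\<in>I. c (?e i) \<in> A}"
      by (intro CollectI exI[of _ "\<lambda>e. v (the_inv ?e e)"])
        (auto simp: fun_eq_iff the_inv_f_f[OF inj_unit_vec])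
  qed auto
  finally show ?thesis unfolding basis_of_def using independent_unit_vec[OF I] I by simp
qed

lemma basis_of_std_mod: "basis_of A (std_mod A n) (unit_vec ` {..<n})"
proof -
  have "std_mod A n = {v. (\<forall>i\<in>{..<n}. v i \<in> A) \<and> (\<forall>i. i \<notin> {..<n} \<longrightarrow> v i = 0)}"
    by (auto simp: std_mod_def)
  then show ?thesis using basis_of_coordinate_module[of "{..<n}"] by simp
qed

lemma submod_std_mod: "is_submod A (std_mod A n)"
  using basis_of_std_mod submod_span_in unfolding basis_of_def by metis

lemma dim_basis_of: "basis_of A M B \<Longrightarrow> KV.dim M = card B"
  by (metis KV.dim_span KV.dim_span_eq_card_independent basis_of_def span_span_in)

lemma dim_std_mod: "KV.dim (std_mod A n) = n"
  using dim_basis_of[OF basis_of_std_mod] by (simp add: card_image[OF inj_unit_vec])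

text \<open>If x = p + q and a nonzero multiple a x lies in M, then a q lies in both M and its
  complement, so q = 0. Hence a summand is determined by its K-span.\<close>

lemma direct_summand_saturated:
  assumes "direct_summand A M N"
  shows "KV.span M \<inter> N = M"
proof (intro equalityI subsetI)
  fix x assume x: "x \<in> KV.span M \<inter> N"
  obtain Q where M: "is_submod A M" and Q: "is_submod A Q" "M \<inter> Q = {0}" "N = {x + y | x y. x \<in> M \<and> y \<in> Q}"
    using assms unfolding direct_summand_def by blast
  obtain p q where pq: "x = p + q" "p \<in> M" "q \<in> Q" using x Q(3) by blast
  obtain a where a: "a \<in> A" "a \<noteq> 0" "a *s x \<in> M" using span_clear_denominator[OF M] x by blast
  have "a *s x - a *s p \<in> M" by (rule submodD(5)[OF M a(3) submodD(3)[OF M a(1) pq(2)]])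
  then have "a *s q \<in> M" unfolding pq(1) by (simp add: KV.scale_right_distrib)
  moreover have "a *s q \<in> Q" by (rule submodD(3)[OF Q(1) a(1) pq(3)])
  ultimately have "a *s q = 0" using Q(2) by blast
  then have "q = 0" using a(2) by simp
  then show "x \<in> M" using pq by simp
next
  fix x assume "x \<in> M"
  then show "x \<in> KV.span M \<inter> N" using assms KV.span_base unfolding direct_summand_def by blast
qed

text \<open>The kernel of f inside N is the complement.\<close>

lemma direct_summandI_projection:
  assumes lin: "Vector_Spaces.linear smult_vec smult_vec f"
    and M: "is_submod A M" and N: "is_submod A N" "M \<subseteq> N"
    and f: "\<And>x. x \<in> N \<Longrightarrow> f x \<in> M" "\<And>x. x \<in> M \<Longrightarrow> f x = x"
  shows "direct_summand A M N"
proof -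
  have add: "f (x + y) = f x + f y" and scale: "f (c *s x) = c *s f x" for x y c
    using lin by (auto simp: Vector_Spaces.linear_iff)
  have diff: "f (x - y) = f x - f y" for x y using add[of "x - y" y] by simp
  have zero: "f 0 = 0" using scale[of 0 0] by simp
  define Q where "Q = {x \<in> N. f x = 0}"
  have "is_submod A Q" unfolding Q_def using submodD[OF N(1)]
    by (auto simp: is_submod_def add scale zero simp del: zero_fun_def)
  moreover have "M \<inter> Q = {0}"
    using f(2) submodD(1)[OF M] submodD(1)[OF N(1)] zero unfolding Q_def by fastforce
  moreover have "N = {x + y | x y. x \<in> M \<and> y \<in> Q}"
  proof (intro equalityI subsetI)
    fix x assume x: "x \<in> N"
    then have "x - f x \<in> Q"
      using submodD(5)[OF N(1) x subsetD[OF N(2) f(1)[OF x]]] f(2)[OF f(1)[OF x]] by (simp add: Q_def diff)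
    then show "x \<in> {x + y | x y. x \<in> M \<and> y \<in> Q}"
      using f(1)[OF x] by (intro CollectI exI[of _ "f x"] exI[of _ "x - f x"]) auto
  next
    fix x assume "x \<in> {x + y | x y. x \<in> M \<and> y \<in> Q}"
    then show "x \<in> N" using N(2) submodD(2)[OF N(1)] unfolding Q_def by auto
  qed
  ultimately show ?thesis unfolding direct_summand_def using M N(2) Q_def by blast
qed

lemma span_Int_std_mod:
  assumes W: "KV.subspace W" "W \<subseteq> std_mod UNIV n"
  shows "KV.span (W \<inter> std_mod A n) = W"
proof (intro equalityI KV.span_minimal W subsetI)
  fix x assume x: "x \<in> W"
  obtain a where a: "a \<in> A" "a \<noteq> 0" "\<forall>i<n. a * x i \<in> A"
    using finite_clear_denominator[of "{..<n}" x] by auto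
  then have "a *s x \<in> W \<inter> std_mod A n" using KV.subspace_scale[OF W(1) x] W(2) x by (auto simp: std_mod_def smult_vec_def)
  then have "inverse a *s (a *s x) \<in> KV.span (W \<inter> std_mod A n)" by (intro KV.span_scale KV.span_base)
  then show "x \<in> KV.span (W \<inter> std_mod A n)" using a(2) by simp
qed auto

section \<open>Free and stably free modules\<close>

lemma free_mod_iso:
  assumes iso: "iso_mod A M N" and M: "is_submod A M" and N: "free_mod A N"
  shows "free_mod A M"
proof -
  obtain f where f: "bij_betw f M N" "\<And>x y. x \<in> M \<Longrightarrow> y \<in> M \<Longrightarrow> f (x + y) = f x + f y"
    "\<And>c x. c \<in> A \<Longrightarrow> x \<in> M \<Longrightarrow> f (c *s x) = c *s f x" using iso unfolding iso_mod_def by blast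
  obtain bs where bs: "set bs \<subseteq> N" "lin_indep A bs" "N = {lincomb c bs | c. \<forall>i<length bs. c i \<in> A}"
    using N unfolding free_mod_def by blast
  define g where "g = inv_into M f"
  have g: "g y \<in> M" "f (g y) = y" if "y \<in> N" for y
    using f(1) that unfolding g_def bij_betw_def by (auto intro: inv_into_into f_inv_into_f)
  have f0: "f 0 = 0" using f(3)[OF zero_in submodD(1)[OF M]] by simp
  \<comment> \<open>f respects the operations only on M and for scalars in A, so the partial sums
    have to be kept inside M.\<close>
  have fsum: "f (\<Sum>i\<in>I. c i *s v i) = (\<Sum>i\<in>I. c i *s f (v i))"
    if "\<And>i. i \<in> I \<Longrightarrow> c i \<in> A" "\<And>i. i \<in> I \<Longrightarrow> v i \<in> M" for c v and I :: "nat set"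
    using that
  proof (induction I rule: infinite_finite_induct)
    case (insert i I)
    then have "(\<Sum>i\<in>I. c i *s v i) \<in> M" by (intro submod_sum[OF M] submodD(3)[OF M]) auto
    then have "f (\<Sum>i\<in>insert i I. c i *s v i) = f (c i *s v i) + f (\<Sum>i\<in>I. c i *s v i)"
      using insert submodD(3)[OF M] f(2) by simp
    also have "\<dots> = c i *s f (v i) + (\<Sum>i\<in>I. c i *s f (v i))" using insert f(3) by simp
    finally show ?case using insert.hyps by (simp add: plus_fun_def)
  qed (simp_all add: f0)
  define cs where "cs = map g bs"
  have csM: "lincomb c cs \<in> M" and fl: "f (lincomb c cs) = lincomb c bs" if c: "\<forall>i<length bs. c i \<in> A" for c
  proof -
    have *: "g (bs ! i) \<in> M" "f (g (bs ! i)) = bs ! i" if "i < length bs" for i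
      using g bs(1) that nth_mem by blast+
    have l: "lincomb c cs = (\<Sum>i<length bs. c i *s g (bs ! i))" by (simp add: cs_def lincomb_eq_sum)
    show "lincomb c cs \<in> M" unfolding l using c * by (intro submod_sum[OF M] submodD(3)[OF M]) auto
    have "f (lincomb c cs) = (\<Sum>i<length bs. c i *s f (g (bs ! i)))" unfolding l using c * by (intro fsum) auto
    also have "\<dots> = lincomb c bs" using * by (simp add: lincomb_eq_sum)
    finally show "f (lincomb c cs) = lincomb c bs" .
  qed
  have "set cs \<subseteq> M" using g bs(1) by (auto simp: cs_def)
  moreover have "lin_indep A cs" unfolding lin_indep_def
  proof (intro allI impI, elim conjE)
    fix c i assume c: "\<forall>i<length cs. c i \<in> A" "lincomb c cs = 0" "i < length cs"
    then have "lincomb c bs = 0" using fl[of c] f0 by (simp add: cs_def)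
    then show "c i = 0" using bs(2) c unfolding lin_indep_def by (simp add: cs_def)
  qed
  moreover have "M = {lincomb c cs | c. \<forall>i<length cs. c i \<in> A}"
  proof (intro equalityI subsetI)
    fix x assume x: "x \<in> M"
    then have "f x \<in> N" using f(1) by (auto simp: bij_betw_def)
    then obtain c where c: "f x = lincomb c bs" "\<forall>i<length bs. c i \<in> A" using bs(3) by blast
    then have "f x = f (lincomb c cs)" using fl by simp
    then have "x = lincomb c cs" using f(1) x csM[OF c(2)] unfolding bij_betw_def inj_on_def by blast
    then show "x \<in> {lincomb c cs | c. \<forall>i<length cs. c i \<in> A}" using c(2) by (auto simp: cs_def)
  next
    fix x assume "x \<in> {lincomb c cs | c. \<forall>i<length cs. c i \<in> A}"
    then show "x \<in> M" using csM by (auto simp: cs_def)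
  qed
  ultimately show ?thesis unfolding free_mod_def by blast
qed

text \<open>The witnesses are a = 0, for which the external sum is V itself, and the length b of a
  basis; the isomorphism takes coordinates with respect to that basis.\<close>

lemma free_mod_imp_stably_free:
  assumes V: "V \<subseteq> std_mod A n" and free: "free_mod A V"
  shows "stably_free A n V"
proof -
  obtain bs where bs: "lin_indep A bs" "V = {lincomb c bs | c. \<forall>i<length bs. c i \<in> A}"
    using free unfolding free_mod_def by blast
  define b where "b = length bs"
  have "std_mod A 0 = {0}" by (auto simp: std_mod_def zero_fun_def)
  then have "dsum_std A n V 0 = {(\<lambda>i. if i < n then v i else 0) | v. v \<in> V}"
    unfolding dsum_std_def by (auto simp: zero_fun_def)
  also have "\<dots> = V"
  proof -
    have "(\<lambda>i. if i < n then v i else 0) = v" if "v \<in> V" for v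
      using V that by (auto simp: std_mod_def fun_eq_iff)
    note * = this
    show ?thesis
    proof (intro equalityI subsetI)
      fix x assume "x \<in> {(\<lambda>i. if i < n then v i else 0) | v. v \<in> V}"
      then show "x \<in> V" using * by auto
    next
      fix x assume "x \<in> V"
      then show "x \<in> {(\<lambda>i. if i < n then v i else 0) | v. v \<in> V}"
        using *[of x] by (intro CollectI exI[of _ x]) simp
    qed
  qed
  finally have ds: "dsum_std A n V 0 = V" .
  define h where "h c = lincomb c bs" for c
  have h: "h (c + d) = h c + h d" "h (a *s c) = a *s h c" for a c d
    unfolding h_def lincomb_eq_sum
    by (auto simp: KV.scale_left_distrib sum.distrib KV.scale_sum_right smult_vec_def[of a c])
  have hV: "h c \<in> V" if "c \<in> std_mod A b" for c
    using that unfolding h_def bs(2) std_mod_def b_def by blast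
  have inj: "inj_on h (std_mod A b)"
  proof (rule inj_onI)
    fix c d assume c: "c \<in> std_mod A b" "d \<in> std_mod A b" "h c = h d"
    have "c - d \<in> std_mod A b" using submodD(5)[OF submod_std_mod c(1,2)] .
    moreover have "h (c - d) = 0" using h(1)[of "c - d" d] c(3) by simp
    ultimately have "\<forall>i<b. (c - d) i = 0" "\<forall>i\<ge>b. (c - d) i = 0"
      using bs(1) unfolding lin_indep_def h_def std_mod_def b_def by blast+
    then have "\<forall>i. c i = d i" by (metis diff_eq_eq add_0 linorder_not_le minus_apply)
    then show "c = d" by (simp add: fun_eq_iff)
  qed
  have surj: "h ` std_mod A b = V"
  proof (intro equalityI subsetI)
    fix x assume "x \<in> V"
    then obtain c where c: "x = lincomb c bs" "\<forall>i<length bs. c i \<in> A" unfolding bs(2) by blast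
    then have "x = h (\<lambda>i. if i < b then c i else 0)" unfolding h_def lincomb_eq_sum b_def by simp
    moreover have "(\<lambda>i. if i < b then c i else 0) \<in> std_mod A b" using c(2) by (simp add: std_mod_def b_def)
    ultimately show "x \<in> h ` std_mod A b" by blast
  qed (use hV in blast)
  define f where "f = inv_into (std_mod A b) h"
  have fh: "f (h c) = c" if "c \<in> std_mod A b" for c unfolding f_def using inv_into_f_f[OF inj that] .
  have bij: "bij_betw f V (std_mod A b)"
    unfolding f_def using inj surj by (intro bij_betw_inv_into) (simp add: bij_betw_def)
  have "f (x + y) = f x + f y" if xy: "x \<in> V" "y \<in> V" for x y
  proof -
    obtain c d where cd: "x = h c" "y = h d" "c \<in> std_mod A b" "d \<in> std_mod A b"
      using xy unfolding surj[symmetric] by blast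
    then show ?thesis using fh[OF submodD(2)[OF submod_std_mod cd(3,4)]] fh by (simp add: h(1))
  qed
  moreover have "f (a *s x) = a *s f x" if ax: "a \<in> A" "x \<in> V" for a x
  proof -
    obtain c where c: "x = h c" "c \<in> std_mod A b" using ax(2) unfolding surj[symmetric] by blast
    then show ?thesis using fh[OF submodD(3)[OF submod_std_mod ax(1) c(2)]] fh by (simp add: h(2))
  qed
  ultimately have "iso_mod A V (std_mod A b)" unfolding iso_mod_def using bij by blast
  then show ?thesis unfolding stably_free_def using ds by metis
qed

end

text \<open>Inside K^(n+a) the external sum is the internal sum of V and the coordinate module E on
  the added coordinates. It is free by assumption, so E can be cancelled.\<close>

lemma (in stable_subring) stably_free_imp_free_mod:
  assumes M: "is_submod A V" and V: "V \<subseteq> std_mod A n" and sf: "stably_free A n V"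
  shows "free_mod A V"
proof -
  obtain a b where iso: "iso_mod A (dsum_std A n V a) (std_mod A b)" using sf unfolding stably_free_def by blast
  define E where "E = {v. (\<forall>i\<in>{n..<n + a}. v i \<in> A) \<and> (\<forall>i. i \<notin> {n..<n + a} \<longrightarrow> v i = 0)}"
  have E: "basis_of A E (unit_vec ` {n..<n + a})" unfolding E_def by (rule basis_of_coordinate_module) simp
  then have Esub: "is_submod A E" using submod_span_in unfolding basis_of_def by metis
  have V0: "v i = 0" if "v \<in> V" "i \<ge> n" for v i using V that by (auto simp: std_mod_def)
  have eq: "dsum_std A n V a = {x + y | x y. x \<in> V \<and> y \<in> E}"
  proof (intro equalityI subsetI)
    fix z assume "z \<in> dsum_std A n V a"
    then obtain v w where vw: "z = (\<lambda>i. if i < n then v i else w (i - n))" "v \<in> V" "w \<in> std_mod A a"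
      unfolding dsum_std_def by blast
    define y where "y = (\<lambda>i. if i < n then 0 else w (i - n))"
    have "y \<in> E" using vw(3) unfolding y_def E_def std_mod_def by auto
    moreover have "z = v + y" using V0[OF vw(2)] unfolding vw(1) y_def by (auto simp: fun_eq_iff)
    ultimately show "z \<in> {x + y | x y. x \<in> V \<and> y \<in> E}" using vw(2) by blast
  next
    fix z assume "z \<in> {x + y | x y. x \<in> V \<and> y \<in> E}"
    then obtain x y where xy: "z = x + y" "x \<in> V" "y \<in> E" by blast
    define w where "w = (\<lambda>i. y (i + n))"
    have "w \<in> std_mod A a" using xy(3) unfolding w_def E_def std_mod_def by auto
    moreover have "z = (\<lambda>i. if i < n then x i else w (i - n))"
      using V0[OF xy(2)] xy(3) unfolding xy(1) w_def E_def by (auto simp: fun_eq_iff)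
    ultimately show "z \<in> dsum_std A n V a" unfolding dsum_std_def using xy(2) by blast
  qed
  have "free_mod A (dsum_std A n V a)"
  proof (rule free_mod_iso[OF iso])
    show "is_submod A (dsum_std A n V a)" unfolding eq by (rule submod_add[OF M Esub])
    show "free_mod A (std_mod A b)" using free_mod_iff basis_of_std_mod by blast
  qed
  then obtain B where "basis_of A (dsum_std A n V a) B" using free_mod_iff by blast
  moreover have "V \<inter> E = {0}"
  proof (intro equalityI subsetI)
    fix x assume x: "x \<in> V \<inter> E"
    then have "x i = 0" for i using V0[of x i] unfolding E_def by (cases "i < n") auto
    then show "x \<in> {0}" by (auto simp: fun_eq_iff)
  qed (use submodD(1)[OF M] submodD(1)[OF Esub] in blast)
  ultimately show ?thesis using cancel_free_summand[OF _ E M eq] free_mod_iff by blast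
qed

section \<open>Localizations of Dedekind domains\<close>

locale dedekind_localization =
  fixes S :: "'a::idom set"
  assumes dedekind: "dedekind_domain TYPE('a)"
    and one_in_S: "1 \<in> S" and mult_in_S: "\<And>s t. s \<in> S \<Longrightarrow> t \<in> S \<Longrightarrow> s * t \<in> S" and zero_notin_S: "0 \<notin> S"
begin

lemma loc_ringI: "s \<in> S \<Longrightarrow> to_fract a / to_fract s \<in> loc_ring S"
  by (auto simp: loc_ring_eq)

lemma loc_ringE:
  assumes "x \<in> loc_ring S"
  obtains a s where "x = to_fract a / to_fract s" "s \<in> S" "to_fract s \<noteq> 0"
  using assms zero_notin_S unfolding loc_ring_eq by force

lemma base_subset_loc: "base_ring \<subseteq> loc_ring S"
proof
  fix x :: "'a fract" assume "x \<in> base_ring"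
  then obtain a where "x = to_fract a / to_fract 1" by (auto simp: base_ring_eq)
  then show "x \<in> loc_ring S" using loc_ringI[OF one_in_S] by blast
qed

lemma power_in_S: "s \<in> S \<Longrightarrow> s ^ k \<in> S"
  by (induction k) (auto simp: one_in_S mult_in_S)

lemma to_fract_power: "to_fract (x ^ k) = to_fract x ^ k"
  by (induction k) auto

lemma stable_subring_loc: "stable_subring (loc_ring S)"
proof
  show "1 \<in> loc_ring S" using loc_ringI[OF one_in_S, of 1] by simp
  fix x y assume "x \<in> loc_ring S" "y \<in> loc_ring S"
  then obtain a s b t where x: "x = to_fract a / to_fract s" "s \<in> S" "to_fract s \<noteq> 0"
    and y: "y = to_fract b / to_fract t" "t \<in> S" "to_fract t \<noteq> 0" by (metis loc_ringE)
  have "x - y = to_fract (a * t - b * s) / to_fract (s * t)" unfolding x(1) y(1) using x(3) y(3) by (simp add: field_simps)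
  then show "x - y \<in> loc_ring S" using loc_ringI[OF mult_in_S[OF x(2) y(2)]] by metis
  have "x * y = to_fract (a * b) / to_fract (s * t)" using x y by simp
  then show "x * y \<in> loc_ring S" using loc_ringI[OF mult_in_S[OF x(2) y(2)]] by metis
next
  fix x :: "'a fract"
  obtain d :: 'a where "d \<noteq> 0" "to_fract d * x \<in> base_ring" using common_denominator[of 1 "\<lambda>_. x"] by auto
  moreover have "to_fract d \<in> base_ring" by (simp add: base_ring_eq)
  ultimately show "\<exists>a\<in>loc_ring S. a \<noteq> 0 \<and> a * x \<in> loc_ring S"
    using base_subset_loc by (intro bexI[of _ "to_fract d"]) auto
next
  fix a b assume "a \<in> loc_ring S" "a \<noteq> 0" "b \<in> loc_ring S"
  then obtain a' t b' s where a: "a = to_fract a' / to_fract t" "t \<in> S" "to_fract t \<noteq> 0"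
    and b: "b = to_fract b' / to_fract s" "s \<in> S" "to_fract s \<noteq> 0" by (metis loc_ringE)
  have "a' \<noteq> 0" using a \<open>a \<noteq> 0\<close> by auto
  then obtain N x r where x: "b' ^ N * (1 - b' * x) = a' * r" using dedekind_power_stable[OF dedekind] by blast
  have x': "to_fract b' ^ N * (1 - to_fract b' * to_fract x) = to_fract a' * to_fract r"
    using arg_cong[OF x, of to_fract] by (simp add: to_fract_power)
  \<comment> \<open>The factor s in the witness \<open>s * x\<close> cancels the denominator of b,
    and the denominators left over are absorbed in the quotient by \<open>s ^ N\<close>.\<close>
  have "b ^ N * (1 - b * to_fract (s * x)) = (to_fract b' ^ N * (1 - to_fract b' * to_fract x)) / to_fract s ^ N"
    using b by (simp add: power_divide)
  also have "\<dots> = a * (to_fract (t * r) / to_fract (s ^ N))"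
    unfolding x' using a by (simp add: to_fract_power)
  finally have "b ^ N * (1 - b * to_fract (s * x)) = a * (to_fract (t * r) / to_fract (s ^ N))" .
  moreover have "to_fract (s * x) \<in> loc_ring S" using subsetD[OF base_subset_loc base_ringI[OF refl]] .
  moreover have "to_fract (t * r) / to_fract (s ^ N) \<in> loc_ring S" by (rule loc_ringI[OF power_in_S[OF b(2)]])
  ultimately show "\<exists>N. \<exists>x\<in>loc_ring S. \<exists>r\<in>loc_ring S. b ^ N * (1 - b * x) = a * r" by blast
qed

end

text \<open>Lets every result on localizations be reused for R itself.\<close>

lemma base_ring_eq_loc: "base_ring = loc_ring {1}"
  by (auto simp: base_ring_eq loc_ring_eq)

lemma stable_subring_base:
  assumes "dedekind_domain TYPE('a::idom)"
  shows "stable_subring (base_ring :: 'a fract set)"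
proof -
  have "dedekind_localization {1 :: 'a}" by standard (use assms in auto)
  then show ?thesis unfolding base_ring_eq_loc by (rule dedekind_localization.stable_subring_loc)
qed

sublocale dedekind_localization \<subseteq> L: stable_subring "loc_ring S" by (rule stable_subring_loc)
sublocale dedekind_localization \<subseteq> R: stable_subring "base_ring :: 'a fract set"
  by (rule stable_subring_base[OF dedekind])

section \<open>Projections of K^n that preserve lattices, and summands as intersections\<close>

text \<open>For a nonzero v in X, invertibility of its fractional ideal gives y with sum of
  \<open>v i * y i\<close> equal to 1 and all \<open>y i * v j\<close> in R. Then
  \<open>\<pi>\<close> projects onto the line of v and maps R^n into itself. The images of the other
  vectors under 1 - \<open>\<pi>\<close> form a smaller set, to which induction applies.\<close>

lemma integral_projection:
  fixes X :: "(nat \<Rightarrow> 'a::idom fract) set"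
  assumes D: "dedekind_domain TYPE('a)" and "finite X" "X \<subseteq> std_mod UNIV n"
  shows "\<exists>f. Vector_Spaces.linear smult_vec smult_vec f \<and> (\<forall>x\<in>std_mod base_ring n. f x \<in> std_mod base_ring n)
    \<and> (\<forall>x. f x \<in> KV.span X) \<and> (\<forall>x\<in>X. f x = x)"
  using assms(2,3)
proof (induction "card X" arbitrary: X rule: less_induct)
  case less
  interpret R: stable_subring "base_ring :: 'a fract set" by (rule stable_subring_base[OF D])
  note R_std = R.submodD[OF R.submod_std_mod]
  have lin_iff: "Vector_Spaces.linear smult_vec smult_vec f \<longleftrightarrow>
      (\<forall>x y. f (x + y) = f x + f y) \<and> (\<forall>c x. f (c *s x) = c *s f x)" for f :: "(nat \<Rightarrow> 'a fract) \<Rightarrow> nat \<Rightarrow> 'a fract"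
    using KV.vector_space_axioms by (auto simp: Vector_Spaces.linear_iff)
  show ?case
  proof (cases "X \<subseteq> {0}")
    case True
    have "Vector_Spaces.linear smult_vec smult_vec (\<lambda>x :: nat \<Rightarrow> 'a fract. 0 :: nat \<Rightarrow> 'a fract)"
      by (simp add: lin_iff)
    then show ?thesis using True R_std(1) KV.span_zero
      by (intro exI[of _ "\<lambda>x :: nat \<Rightarrow> 'a fract. 0 :: nat \<Rightarrow> 'a fract"]) blast
  next
    case False
    then obtain v where v: "v \<in> X" "v \<noteq> 0" by blast
    then have v0: "v j = 0" if "j \<ge> n" for j using less.prems(2) that by (auto simp: std_mod_def)
    obtain i0 where i0: "v i0 \<noteq> 0" using v(2) by (auto simp: fun_eq_iff)
    then have "i0 < n" using v0 by (meson not_less)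
    then obtain y where y: "(\<Sum>i<n. v i * y i) = 1" "\<And>i j. i < n \<Longrightarrow> j < n \<Longrightarrow> y i * v j \<in> base_ring"
      using dedekind_vector_invertible[OF D, of i0 n v] i0 by blast
    define \<pi> where "\<pi> x = (\<Sum>i<n. x i * y i) *s v" for x
    have \<pi>add: "\<pi> (x + z) = \<pi> x + \<pi> z" and \<pi>scale: "\<pi> (c *s x) = c *s \<pi> x" for x z c
      unfolding \<pi>_def
      by (auto simp: distrib_right sum.distrib KV.scale_left_distrib smult_vec_def[of c x] sum_distrib_left mult.assoc)
    have \<pi>v: "\<pi> v = v" unfolding \<pi>_def y(1) by simp
    have \<pi>R: "\<pi> x \<in> std_mod base_ring n" if x: "x \<in> std_mod base_ring n" for x
    proof -
      have "\<pi> x j \<in> base_ring" if "j < n" for j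
      proof -
        have "\<pi> x j = (\<Sum>i<n. x i * (y i * v j))"
          unfolding \<pi>_def smult_vec_def sum_distrib_right by (simp add: mult.assoc)
        also have "\<dots> \<in> base_ring" using x y(2) that by (auto intro!: R.sum_in R.mult_in[of "x _"] simp: std_mod_def)
        finally show ?thesis .
      qed
      then show ?thesis using v0 by (auto simp: std_mod_def) (simp add: \<pi>_def smult_vec_def)
    qed
    have \<pi>K: "\<pi> x \<in> KV.span X" for x unfolding \<pi>_def using v(1) by (intro KV.span_scale KV.span_base)
    define X' where "X' = (\<lambda>x. x - \<pi> x) ` (X - {v})"
    have "card X' \<le> card (X - {v})" unfolding X'_def using less.prems(1) by (intro card_image_le) auto
    also have "\<dots> < card X" using v(1) less.prems(1) by (rule card_Diff1_less[rotated])
    finally have "card X' < card X" .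
    moreover have "finite X'" unfolding X'_def using less.prems(1) by simp
    moreover have X'X: "X' \<subseteq> KV.span X" unfolding X'_def using \<pi>K by (auto intro!: KV.span_diff intro: KV.span_base)
    then have "X' \<subseteq> std_mod UNIV n" using span_subset_std_mod[OF less.prems(2)] by blast
    ultimately obtain f where f: "Vector_Spaces.linear smult_vec smult_vec f"
      "\<forall>x\<in>std_mod base_ring n. f x \<in> std_mod base_ring n" "\<forall>x. f x \<in> KV.span X'" "\<forall>x\<in>X'. f x = x"
      using less.hyps[of X'] by blast
    have fadd: "f (x + z) = f x + f z" and fscale: "f (c *s x) = c *s f x" for x z c using f(1) lin_iff by auto
    have f0: "f 0 = 0" using fscale[of 0 0] by simp
    have "KV.span X' \<subseteq> KV.span X" using X'X by (intro KV.span_minimal) auto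
    then have fX: "f x \<in> KV.span X" for x using f(3) by blast
    \<comment> \<open>Glues the projection onto the line with the one for X': for x in X other than
      v, the difference x - \<open>\<pi> x\<close> lies in X' and is fixed by f.\<close>
    define \<rho> where "\<rho> x = \<pi> x + f (x - \<pi> x)" for x
    have "\<rho> (x + z) = \<rho> x + \<rho> z" for x z
    proof -
      have "x + z - \<pi> (x + z) = (x - \<pi> x) + (z - \<pi> z)" by (simp add: \<pi>add)
      then show ?thesis unfolding \<rho>_def by (simp only: fadd) (simp add: \<pi>add)
    qed
    moreover have "\<rho> (c *s x) = c *s \<rho> x" for c x
    proof -
      have "c *s x - \<pi> (c *s x) = c *s (x - \<pi> x)" by (simp add: \<pi>scale KV.scale_right_diff_distrib)
      then show ?thesis unfolding \<rho>_def by (simp only: fscale) (simp add: \<pi>scale KV.scale_right_distrib)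
    qed
    ultimately have "Vector_Spaces.linear smult_vec smult_vec \<rho>" by (simp add: lin_iff)
    moreover have "\<rho> x \<in> std_mod base_ring n" if "x \<in> std_mod base_ring n" for x
      unfolding \<rho>_def using \<pi>R[OF that] f(2) R_std(5)[OF that \<pi>R[OF that]] by (intro R_std(2)) auto
    moreover have "\<rho> x \<in> KV.span X" for x unfolding \<rho>_def by (intro KV.span_add \<pi>K fX)
    moreover have "\<rho> x = x" if "x \<in> X" for x
    proof (cases "x = v")
      case True
      then show ?thesis unfolding \<rho>_def using \<pi>v f0 by simp
    next
      case False
      then have "x - \<pi> x \<in> X'" unfolding X'_def using that by blast
      then show ?thesis unfolding \<rho>_def using f(4) by simp
    qed
    ultimately show ?thesis by (intro exI[of _ \<rho>]) blast
  qed
qed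

context dedekind_localization
begin

lemma loc_clear_denominator:
  assumes "x \<in> std_mod (loc_ring S) n"
  obtains s where "s \<in> S" "to_fract s *s x \<in> std_mod base_ring n"
proof -
  obtain s where "s \<in> S" "\<forall>i<n. to_fract s * x i \<in> base_ring"
    using loc_ring_common_denominator[OF one_in_S mult_in_S zero_notin_S, of n x] assms by (auto simp: std_mod_def)
  then show thesis using assms by (intro that[of s]) (auto simp: std_mod_def smult_vec_def)
qed

lemma scale_inverse_denominator: "s \<in> S \<Longrightarrow> (1 / to_fract s) *s (to_fract s *s x) = x"
  using zero_notin_S by (cases "s = 0") auto

lemma std_mod_base_subset: "std_mod base_ring n \<subseteq> std_mod (loc_ring S) n"
  using base_subset_loc by (auto simp: std_mod_def)

text \<open>The projection found over R also preserves R_S^n: scale x into R^n by a denominator in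
  S, apply f, and divide again.\<close>

lemma subspace_projection:
  assumes W: "KV.subspace W" "W \<subseteq> std_mod UNIV n"
  obtains f where "Vector_Spaces.linear smult_vec smult_vec f"
    "\<And>x. x \<in> std_mod (loc_ring S) n \<Longrightarrow> f x \<in> W \<inter> std_mod (loc_ring S) n" "\<And>x. x \<in> W \<Longrightarrow> f x = x"
proof -
  obtain X where X: "X \<subseteq> W" "KV.independent X" "W \<subseteq> KV.span X"
    using KV.maximal_independent_subset[of W] by metis
  \<comment> \<open>The unit vectors span K^n, so the independent set X is finite, as
    \<open>integral_projection\<close> requires.\<close>
  have "std_mod UNIV n \<subseteq> KV.span (std_mod (loc_ring S) n)"
    using L.span_Int_std_mod[OF subspace_std_mod subset_refl, of n] by (metis KV.span_mono inf_le2)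
  also have "\<dots> = KV.span (unit_vec ` {..<n})"
    using L.basis_of_std_mod[of n] L.span_span_in unfolding basis_of_def by metis
  finally have "X \<subseteq> KV.span (unit_vec ` {..<n})" using X(1) W(2) by blast
  then have fin: "finite X" using KV.independent_span_bound[OF _ X(2)] by blast
  have WX: "W = KV.span X" using X W(1) by (simp add: KV.span_subspace)
  obtain f where f: "Vector_Spaces.linear smult_vec smult_vec f"
    "\<forall>x\<in>std_mod base_ring n. f x \<in> std_mod base_ring n" "\<forall>x. f x \<in> W" "\<forall>x\<in>X. f x = x"
    using integral_projection[OF dedekind fin] X(1) W(2) unfolding WX by blast
  have fadd: "f (x + z) = f x + f z" and fscale: "f (c *s x) = c *s f x" for x z c
    using f(1) by (auto simp: Vector_Spaces.linear_iff)
  have "f x \<in> std_mod (loc_ring S) n" if x: "x \<in> std_mod (loc_ring S) n" for x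
  proof -
    obtain s where s: "s \<in> S" "to_fract s *s x \<in> std_mod base_ring n" using loc_clear_denominator[OF x] .
    have "to_fract s *s f x \<in> std_mod (loc_ring S) n"
      using f(2) s(2) std_mod_base_subset by (auto simp flip: fscale)
    moreover have "1 / to_fract s \<in> loc_ring S" using loc_ringI[OF s(1), of 1] by simp
    ultimately have "(1 / to_fract s) *s (to_fract s *s f x) \<in> std_mod (loc_ring S) n"
      by (rule L.submodD(3)[OF L.submod_std_mod, rotated])
    then show ?thesis using scale_inverse_denominator[OF s(1)] by simp
  qed
  moreover have "KV.subspace {x. f x = x}"
    using fscale[of 0 0] by (auto simp: KV.subspace_def fadd fscale)
  then have "f x = x" if "x \<in> W" for x
    using KV.span_minimal[of X "{x. f x = x}"] f(4) that unfolding WX by blast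
  ultimately show thesis using that f(1,3) by blast
qed

text \<open>The projection of the whole standard module restricts to every intermediate N. With N
  the standard module this produces vertices, and with N a larger summand it makes inclusions of
  summands split.\<close>

lemma direct_summand_Int_of_subset:
  assumes W: "KV.subspace W" "W \<subseteq> std_mod UNIV n" and N: "is_submod (loc_ring S) N"
    "W \<inter> std_mod (loc_ring S) n \<subseteq> N" "N \<subseteq> std_mod (loc_ring S) n"
  shows "direct_summand (loc_ring S) (W \<inter> std_mod (loc_ring S) n) N"
proof -
  obtain f where f: "Vector_Spaces.linear smult_vec smult_vec f"
    "\<And>x. x \<in> std_mod (loc_ring S) n \<Longrightarrow> f x \<in> W \<inter> std_mod (loc_ring S) n" "\<And>x. x \<in> W \<Longrightarrow> f x = x"
    using subspace_projection[OF W] by blast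
  show ?thesis
    using f N by (intro L.direct_summandI_projection[OF f(1)] L.submod_Int L.submod_subspace[OF W(1)] L.submod_std_mod) blast+
qed

lemma direct_summand_Int:
  assumes "KV.subspace W" "W \<subseteq> std_mod UNIV n"
  shows "direct_summand (loc_ring S) (W \<inter> std_mod (loc_ring S) n) (std_mod (loc_ring S) n)"
  using assms by (intro direct_summand_Int_of_subset L.submod_std_mod) auto

end

lemma (in dedekind_localization) localization_at_one: "dedekind_localization {1 :: 'a}"
  by standard (use dedekind in auto)

context dedekind_localization
begin

lemmas base_direct_summand_Int_of_subset =
  dedekind_localization.direct_summand_Int_of_subset[OF localization_at_one, folded base_ring_eq_loc]
lemmas base_direct_summand_Int =
  dedekind_localization.direct_summand_Int[OF localization_at_one, folded base_ring_eq_loc]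

section \<open>Correspondence of vertices\<close>

lemma tensor_loc_Int:
  assumes W: "KV.subspace W"
  shows "tensor_loc S (W \<inter> std_mod base_ring n) = W \<inter> std_mod (loc_ring S) n"
  unfolding tensor_loc_def
proof (intro equalityI L.span_in_least L.submod_Int L.submod_subspace[OF W] L.submod_std_mod)
  show "W \<inter> std_mod base_ring n \<subseteq> W \<inter> std_mod (loc_ring S) n" using std_mod_base_subset by blast
  show "W \<inter> std_mod (loc_ring S) n \<subseteq> span_in (loc_ring S) (W \<inter> std_mod base_ring n)"
  proof
    fix x assume x: "x \<in> W \<inter> std_mod (loc_ring S) n"
    then obtain s where s: "s \<in> S" "to_fract s *s x \<in> std_mod base_ring n" using loc_clear_denominator by blast
    then have "to_fract s *s x \<in> span_in (loc_ring S) (W \<inter> std_mod base_ring n)"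
      using KV.subspace_scale[OF W] x by (intro L.span_in_base) auto
    moreover have "1 / to_fract s \<in> loc_ring S" using loc_ringI[OF s(1), of 1] by simp
    ultimately have "(1 / to_fract s) *s (to_fract s *s x) \<in> span_in (loc_ring S) (W \<inter> std_mod base_ring n)"
      by (rule L.span_inD(3)[rotated])
    then show "x \<in> span_in (loc_ring S) (W \<inter> std_mod base_ring n)" using scale_inverse_denominator[OF s(1)] by simp
  qed
qed

lemma rel_vertexE:
  assumes "rel_vertex S n P"
  obtains W where "W = KV.span P" "KV.subspace W" "W \<subseteq> std_mod UNIV n" "P = W \<inter> std_mod base_ring n"
    "tensor_loc S P = W \<inter> std_mod (loc_ring S) n"
proof -
  have ds: "direct_summand base_ring P (std_mod base_ring n)" using assms by (simp add: rel_vertex_def)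
  define W where "W = KV.span P"
  have "W \<subseteq> std_mod UNIV n" unfolding W_def
    using ds by (intro span_subset_std_mod) (auto simp: direct_summand_def)
  moreover have P: "P = W \<inter> std_mod base_ring n" unfolding W_def using R.direct_summand_saturated[OF ds] by simp
  moreover have "KV.subspace W" unfolding W_def by simp
  moreover have "tensor_loc S P = W \<inter> std_mod (loc_ring S) n" using tensor_loc_Int[OF \<open>KV.subspace W\<close>] P by metis
  ultimately show thesis using that[of W] W_def by blast
qed

lemma direct_summandE:
  assumes "direct_summand (loc_ring S) V (std_mod (loc_ring S) n)"
  obtains W where "W = KV.span V" "KV.subspace W" "W \<subseteq> std_mod UNIV n" "V = W \<inter> std_mod (loc_ring S) n"
proof -
  have "KV.span V \<subseteq> std_mod UNIV n"
    using assms by (intro span_subset_std_mod) (auto simp: direct_summand_def)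
  moreover have "V = KV.span V \<inter> std_mod (loc_ring S) n" using L.direct_summand_saturated[OF assms] by simp
  ultimately show thesis using that[of "KV.span V"] by blast
qed

text \<open>Cancelling V from N shows that an arbitrary complement of V is free.\<close>

lemma free_complement:
  assumes V: "direct_summand (loc_ring S) V N" "free_mod (loc_ring S) V" and N: "free_mod (loc_ring S) N"
  obtains Q D where "is_submod (loc_ring S) Q" "V \<inter> Q = {0}" "N = {x + y | x y. x \<in> V \<and> y \<in> Q}"
    "basis_of (loc_ring S) Q D"
proof -
  obtain Q where Q: "is_submod (loc_ring S) Q" "V \<inter> Q = {0}" "N = {x + y | x y. x \<in> V \<and> y \<in> Q}"
    using V(1) unfolding direct_summand_def by blast
  obtain B C where BC: "basis_of (loc_ring S) N B" "basis_of (loc_ring S) V C"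
    using V(2) N L.free_mod_iff by blast
  have "N = {x + y | x y. x \<in> Q \<and> y \<in> V}" 
  proof -
    have "(\<exists>x y. z = x + y \<and> x \<in> V \<and> y \<in> Q) \<longleftrightarrow> (\<exists>x y. z = x + y \<and> x \<in> Q \<and> y \<in> V)" for z
      using add.commute[where 'a = "nat \<Rightarrow> 'a fract"] by (iprover)
    then show ?thesis unfolding Q(3) by simp
  qed
  moreover have "Q \<inter> V = {0}" using Q(2) by blast
  ultimately obtain D where "basis_of (loc_ring S) Q D" using L.cancel_free_summand[OF BC Q(1)] by blast
  with Q show thesis by (rule that)
qed

lemma free_mod_std_mod: "free_mod (loc_ring S) (std_mod (loc_ring S) n)"
  using L.free_mod_iff L.basis_of_std_mod by blast

text \<open>Cancellation acts twice: it turns the stable freeness that encodes [P] in H into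
  freeness, and it makes the complement, and so the quotient, free.\<close>

lemma tits_vertex_tensor_loc:
  assumes P: "rel_vertex S n P"
  shows "tits_vertex (loc_ring S) n (tensor_loc S P)" "tensor_loc S P \<inter> std_mod base_ring n = P"
proof -
  obtain W where W: "KV.subspace W" "W \<subseteq> std_mod UNIV n" "P = W \<inter> std_mod base_ring n"
    and V: "tensor_loc S P = W \<inter> std_mod (loc_ring S) n" using rel_vertexE[OF P] by metis
  have ds: "direct_summand (loc_ring S) (tensor_loc S P) (std_mod (loc_ring S) n)"
    unfolding V by (rule direct_summand_Int[OF W(1,2)])
  have PV: "P \<subseteq> tensor_loc S P" unfolding tensor_loc_def by (rule L.span_in_superset)
  show VP: "tensor_loc S P \<inter> std_mod base_ring n = P" using V W(3) std_mod_base_subset by blast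
  have sub: "is_submod (loc_ring S) (tensor_loc S P)" unfolding tensor_loc_def by (rule L.submod_span_in)
  have free: "free_mod (loc_ring S) (tensor_loc S P)"
  proof (rule L.stably_free_imp_free_mod[OF sub])
    show "stably_free (loc_ring S) n (tensor_loc S P)" using P by (simp add: rel_vertex_def)
  qed (simp add: V)
  have "tensor_loc S P \<noteq> {0}"
    using P PV R.submodD(1) unfolding rel_vertex_def direct_summand_def by blast
  moreover have "tensor_loc S P \<noteq> std_mod (loc_ring S) n"
    using P VP std_mod_base_subset unfolding rel_vertex_def by blast
  moreover obtain Q D where "is_submod (loc_ring S) Q" and Q: "tensor_loc S P \<inter> Q = {0}"
    "std_mod (loc_ring S) n = {x + y | x y. x \<in> tensor_loc S P \<and> y \<in> Q}" "basis_of (loc_ring S) Q D"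
    by (rule free_complement[OF ds free free_mod_std_mod])
  have "free_mod (loc_ring S) Q" using Q(3) L.free_mod_iff by blast
  then have "free_quot (loc_ring S) (std_mod (loc_ring S) n) (tensor_loc S P)"
    by (rule L.free_quotI[OF sub Q(1,2)])
  ultimately show "tits_vertex (loc_ring S) n (tensor_loc S P)"
    unfolding tits_vertex_def using ds free by blast
qed

lemma rel_vertex_Int_base:
  assumes V: "tits_vertex (loc_ring S) n V"
  shows "rel_vertex S n (V \<inter> std_mod base_ring n)" "tensor_loc S (V \<inter> std_mod base_ring n) = V"
proof -
  obtain W where W: "KV.subspace W" "W \<subseteq> std_mod UNIV n" "V = W \<inter> std_mod (loc_ring S) n"
    using V direct_summandE unfolding tits_vertex_def by metis
  have P: "V \<inter> std_mod base_ring n = W \<inter> std_mod base_ring n" unfolding W(3) using std_mod_base_subset by blast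
  show t: "tensor_loc S (V \<inter> std_mod base_ring n) = V" using tensor_loc_Int[OF W(1), of n] W(3) P by simp
  have "direct_summand base_ring (V \<inter> std_mod base_ring n) (std_mod base_ring n)"
    unfolding P by (rule base_direct_summand_Int[OF W(1,2)])
  moreover have "V \<inter> std_mod base_ring n \<noteq> {0}"
  proof
    assume "V \<inter> std_mod base_ring n = {0}"
    then have "V = span_in (loc_ring S) {0}" using t unfolding tensor_loc_def by simp
    also have "\<dots> = {0}" using L.zero_in by (auto simp: L.span_in_single)
    finally show False using V by (simp add: tits_vertex_def)
  qed
  moreover have "V \<inter> std_mod base_ring n \<noteq> std_mod base_ring n"
  proof
    assume "V \<inter> std_mod base_ring n = std_mod base_ring n"
    \<comment> \<open>R^n is written as its intersection with the whole space K^n so that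
      \<open>tensor_loc_Int\<close> applies.\<close>
    then have "V = tensor_loc S (std_mod UNIV n \<inter> std_mod base_ring n)"
      using t by (simp add: inf.absorb2 std_mod_def subset_iff Collect_mono_iff)
    also have "\<dots> = std_mod UNIV n \<inter> std_mod (loc_ring S) n" by (rule tensor_loc_Int[OF subspace_std_mod])
    also have "\<dots> = std_mod (loc_ring S) n" by (auto simp: std_mod_def)
    finally show False using V by (simp add: tits_vertex_def)
  qed
  moreover have "stably_free (loc_ring S) n V"
    using V W(3) by (intro L.free_mod_imp_stably_free) (auto simp: tits_vertex_def)
  ultimately show "rel_vertex S n (V \<inter> std_mod base_ring n)" unfolding rel_vertex_def t by blast
qed

end

section \<open>Completing flags\<close>

context frac_subring
begin

text \<open>Coordinates over B are unique. So part of a basis spans a saturated submodule, which is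
  how the intermediate members of a flag become summands.\<close>

lemma span_Int_span_in:
  assumes B: "finite B" "KV.independent B" and E: "E \<subseteq> B"
  shows "KV.span E \<inter> span_in A B = span_in A E"
proof (intro equalityI subsetI)
  fix x assume x: "x \<in> KV.span E \<inter> span_in A B"
  have finE: "finite E" using E B(1) finite_subset by blast
  obtain c where c: "x = (\<Sum>b\<in>B. c b *s b)" "\<forall>b\<in>B. c b \<in> A" using x by (auto simp: span_in_finite[OF B(1)])
  obtain u where u: "x = (\<Sum>b\<in>E. u b *s b)" using x by (auto simp: KV.span_finite[OF finE])
  define w where "w b = (if b \<in> E then u b else 0)" for b
  have "(\<Sum>b\<in>B. w b *s b) = (\<Sum>b\<in>E. w b *s b)"
    using B(1) E by (intro sum.mono_neutral_right) (auto simp: w_def)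
  also have "\<dots> = x" unfolding u by (simp add: w_def)
  finally have "(\<Sum>b\<in>B. (c b - w b) *s b) = 0" using c(1) by (simp add: KV.scale_left_diff_distrib sum_subtractf)
  then have "c b - w b = 0" if "b \<in> B" for b
    using KV.independentD[OF B(2,1) subset_refl, of "\<lambda>b. c b - w b"] that by blast
  then have "u b \<in> A" if "b \<in> E" for b using that E c(2) by (force simp: w_def)
  then show "x \<in> span_in A E" unfolding span_in_finite[OF finE] u by blast
next
  fix x assume "x \<in> span_in A E"
  then show "x \<in> KV.span E \<inter> span_in A B" using span_in_subset_span span_in_mono[OF E] by blast
qed

lemma basis_of_direct_sum:
  assumes C: "basis_of A M C" and D: "basis_of A Q D" and MQ: "M \<inter> Q = {0}"
    and N: "N = {x + y | x y. x \<in> M \<and> y \<in> Q}"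
  shows "basis_of A N (C \<union> D)" "C \<inter> D = {}"
proof -
  have CD: "finite C" "finite D" "KV.independent C" "KV.independent D" "M = span_in A C" "Q = span_in A D"
    using C D by (auto simp: basis_of_def)
  have "C \<inter> D \<subseteq> {0}" using MQ span_in_superset[of C] span_in_superset[of D] CD(5,6) by blast
  moreover have "0 \<notin> C" using CD(3) KV.dependent_zero by blast
  ultimately show dis: "C \<inter> D = {}" by blast
  have "KV.independent (C \<union> D)"
  proof
    assume "KV.dependent (C \<union> D)"
    then obtain u v where u: "v \<in> C \<union> D" "u v \<noteq> 0" "(\<Sum>b\<in>C \<union> D. u b *s b) = 0"
      using KV.dependent_finite[of "C \<union> D"] CD(1,2) by blast
    \<comment> \<open>The relation has coefficients in K; scaled into A, its two halves lie in M and
      Q.\<close>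
    obtain a where a: "a \<in> A" "a \<noteq> 0" "\<forall>b\<in>C \<union> D. a * u b \<in> A"
      using finite_clear_denominator[of "C \<union> D" u] CD(1,2) by auto
    define x where "x = (\<Sum>b\<in>C. (a * u b) *s b)"
    define y where "y = (\<Sum>b\<in>D. (a * u b) *s b)"
    have "x \<in> M" "y \<in> Q" unfolding x_def y_def CD using a(3)
      by (auto intro!: submod_sum[OF submod_span_in] span_inD(3) intro: span_in_base)
    have "a *s (\<Sum>b\<in>C \<union> D. u b *s b) = x + y" unfolding x_def y_def
      using sum.union_disjoint[OF CD(1,2) dis] by (simp add: KV.scale_sum_right)
    then have "x = - y" using u(3) by (simp add: eq_neg_iff_add_eq_0)
    then have "x \<in> Q" using \<open>y \<in> Q\<close> submodD(4)[OF submod_span_in] CD(6) by blast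
    then have "x = 0" using \<open>x \<in> M\<close> MQ by blast
    then have "y = 0" using \<open>x = - y\<close> by simp
    have "a * u v = 0"
      using u(1) KV.independentD[OF CD(3,1) subset_refl, of "\<lambda>b. a * u b" v]
        KV.independentD[OF CD(4,2) subset_refl, of "\<lambda>b. a * u b" v] \<open>x = 0\<close> \<open>y = 0\<close>
      unfolding x_def y_def by blast
    then show False using a(2) u(2) by simp
  qed
  moreover have "N = span_in A (C \<union> D)" unfolding N span_in_Un CD(5,6) ..
  ultimately show "basis_of A N (C \<union> D)" unfolding basis_of_def using CD(1,2) by blast
qed

end

context dedekind_localization
begin

definition free_summand :: "nat \<Rightarrow> (nat \<Rightarrow> 'a fract) set \<Rightarrow> bool" where
  "free_summand n V \<longleftrightarrow> direct_summand (loc_ring S) V (std_mod (loc_ring S) n) \<and> free_mod (loc_ring S) V"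

lemma free_summand_std_mod: "free_summand n (std_mod (loc_ring S) n)"
proof -
  have "std_mod UNIV n \<inter> std_mod (loc_ring S) n = std_mod (loc_ring S) n" by (auto simp: std_mod_def)
  then show ?thesis unfolding free_summand_def
    using direct_summand_Int[OF subspace_std_mod subset_refl, of n] free_mod_std_mod by simp
qed

lemma basis_of_zero: "basis_of (loc_ring S) {0} {}"
  unfolding basis_of_def using KV.independent_empty by (auto simp: L.span_in_finite)

lemma free_summand_zero: "free_summand n {0}"
proof -
  have "{0} \<inter> std_mod (loc_ring S) n = {0}" using L.submodD(1)[OF L.submod_std_mod] by blast
  moreover have "{0} \<subseteq> std_mod UNIV n" by (auto simp: std_mod_def)
  ultimately show ?thesis unfolding free_summand_def
    using direct_summand_Int[OF KV.subspace_single_0, of n] basis_of_zero L.free_mod_iff by metis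
qed

text \<open>Nested free modules of equal rank have the same K-span, and a summand is determined by
  its span.\<close>

lemma free_summand_dim_less:
  assumes V: "free_summand n V" and V': "free_summand n V'" and sub: "V \<subset> V'"
  shows "KV.dim V < KV.dim V'"
proof (rule ccontr)
  assume "\<not> ?thesis"
  obtain B B' where B: "basis_of (loc_ring S) V B" and B': "basis_of (loc_ring S) V' B'"
    using V V' L.free_mod_iff unfolding free_summand_def by blast
  then have "card B' \<le> card B" using \<open>\<not> _\<close> L.dim_basis_of by (metis not_less)
  have bas: "KV.independent B" "finite B'" "V = span_in (loc_ring S) B" "V' = span_in (loc_ring S) B'"
    using B B' by (auto simp: basis_of_def)
  have "B \<subseteq> KV.span B'"
    using sub L.span_in_superset[of B] L.span_in_subset_span[of B'] bas(3,4) by blast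
  then have "B' \<subseteq> KV.span B" using spanned_if_card_le bas \<open>card B' \<le> card B\<close> by blast
  then have "KV.span B' \<subseteq> KV.span B" by (intro KV.span_minimal) auto
  then have "V' \<subseteq> KV.span V"
    using L.span_in_subset_span[of B'] L.span_span_in[of B] bas(3,4) by blast
  then have "V' \<subseteq> KV.span V \<inter> std_mod (loc_ring S) n"
    using V' unfolding free_summand_def direct_summand_def by blast
  also have "\<dots> = V" using V L.direct_summand_saturated unfolding free_summand_def by blast
  finally show False using sub by blast
qed

lemma free_summand_subset_iff_dim_le:
  assumes "free_summand n V" "free_summand n V'" "V \<subseteq> V' \<or> V' \<subseteq> V"
  shows "V \<subseteq> V' \<longleftrightarrow> KV.dim V \<le> KV.dim V'"
  using assms free_summand_dim_less[of n V V'] free_summand_dim_less[of n V' V]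
  by (metis order.order_iff_strict not_le psubsetI)

text \<open>Lo splits off from Up with a free complement, so a basis of Lo extends to one of Up.
  Adding d - dim Lo of the new vectors to the basis of Lo spans the desired V.\<close>

lemma free_summand_interpolate:
  assumes Lo: "free_summand n Lo" and Up: "free_summand n Up" and sub: "Lo \<subseteq> Up"
    and d: "KV.dim Lo < d" "d < KV.dim Up"
  obtains V where "free_summand n V" "Lo \<subseteq> V" "V \<subseteq> Up" "KV.dim V = d"
proof -
  have Lo': "direct_summand (loc_ring S) Lo (std_mod (loc_ring S) n)" "free_mod (loc_ring S) Lo"
    and Up': "direct_summand (loc_ring S) Up (std_mod (loc_ring S) n)" "free_mod (loc_ring S) Up"
    using Lo Up by (auto simp: free_summand_def)
  obtain W where W: "KV.subspace W" "W \<subseteq> std_mod UNIV n" "Lo = W \<inter> std_mod (loc_ring S) n"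
    using direct_summandE[OF Lo'(1)] by metis
  have UpS: "is_submod (loc_ring S) Up" "Up \<subseteq> std_mod (loc_ring S) n"
    using Up'(1) by (auto simp: direct_summand_def)
  have "direct_summand (loc_ring S) Lo Up"
    unfolding W(3) using sub W(3) by (intro direct_summand_Int_of_subset W UpS) simp
  then obtain Q D where "is_submod (loc_ring S) Q" and Q: "Lo \<inter> Q = {0}" "Up = {x + y | x y. x \<in> Lo \<and> y \<in> Q}"
    "basis_of (loc_ring S) Q D"
    by (rule free_complement[OF _ Lo'(2) Up'(2)])
  obtain C where C: "basis_of (loc_ring S) Lo C" using Lo'(2) L.free_mod_iff by blast
  have CD: "basis_of (loc_ring S) Up (C \<union> D)" "C \<inter> D = {}"
    using L.basis_of_direct_sum[OF C Q(3,1,2)] .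
  have fin: "finite C" "finite D" using C Q(3) by (auto simp: basis_of_def)
  have card: "card C = KV.dim Lo" "card C + card D = KV.dim Up"
    using L.dim_basis_of[OF C] L.dim_basis_of[OF CD(1)] card_Un_disjoint[OF fin CD(2)] by auto
  then obtain D' where D': "D' \<subseteq> D" "card D' = d - card C"
    using obtain_subset_with_card_n[of "d - card C" D] d by (metis add_diff_cancel_left' diff_le_mono less_imp_le)
  define E where "E = C \<union> D'"
  have E: "E \<subseteq> C \<union> D" "finite E" using D'(1) fin finite_subset unfolding E_def by auto
  have "card E = card C + card D'"
    unfolding E_def using fin D'(1) CD(2) finite_subset[OF D'(1)] by (intro card_Un_disjoint) auto
  then have cardE: "card E = d" using D'(2) card d by simp
  define V where "V = span_in (loc_ring S) E"
  have UpCD: "Up = span_in (loc_ring S) (C \<union> D)" "finite (C \<union> D)" "KV.independent (C \<union> D)"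
    using CD(1) by (auto simp: basis_of_def)
  have basE: "basis_of (loc_ring S) V E"
    unfolding basis_of_def V_def using E KV.independent_mono[OF UpCD(3) E(1)] by simp
  have "Lo \<subseteq> V" unfolding V_def E_def using C L.span_in_mono[of C "C \<union> D'"] by (auto simp: basis_of_def)
  have "V \<subseteq> Up" unfolding V_def UpCD(1) by (rule L.span_in_mono[OF E(1)])
  have EK: "KV.span E \<subseteq> KV.span Up"
    using KV.span_mono[OF E(1)] L.span_span_in[of "C \<union> D"] UpCD(1) by simp
  then have EK': "KV.span E \<subseteq> std_mod UNIV n" using span_subset_std_mod[OF UpS(2)] by blast
  \<comment> \<open>Up is saturated in the standard module and V in Up, so V is the intersection of
    a subspace with the standard module and therefore a summand.\<close>
  have "KV.span E \<inter> std_mod (loc_ring S) n = KV.span E \<inter> Up"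
    using EK L.direct_summand_saturated[OF Up'(1)] UpS(2) by blast
  also have "\<dots> = V" unfolding V_def UpCD(1) by (rule L.span_Int_span_in[OF UpCD(2,3) E(1)])
  finally have VE: "KV.span E \<inter> std_mod (loc_ring S) n = V" .
  have "direct_summand (loc_ring S) V (std_mod (loc_ring S) n)"
    using direct_summand_Int[OF KV.subspace_span EK'] unfolding VE .
  then have "free_summand n V" unfolding free_summand_def using basE L.free_mod_iff by blast
  moreover have "KV.dim V = d" using L.dim_basis_of[OF basE] cardE by simp
  ultimately show thesis using that \<open>Lo \<subseteq> V\<close> \<open>V \<subseteq> Up\<close> by blast
qed

definition free_chain :: "nat \<Rightarrow> (nat \<Rightarrow> 'a fract) set set \<Rightarrow> bool" where
  "free_chain n T \<longleftrightarrow> finite T \<and> (\<forall>V\<in>T. free_summand n V \<and> V \<noteq> {0} \<and> V \<noteq> std_mod (loc_ring S) n)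
    \<and> (\<forall>V\<in>T. \<forall>V'\<in>T. V \<subseteq> V' \<or> V' \<subseteq> V)"

lemma free_summand_bounds:
  assumes "free_summand n V"
  shows "{0} \<subseteq> V" "V \<subseteq> std_mod (loc_ring S) n"
  using assms L.submodD(1) unfolding free_summand_def direct_summand_def by auto

lemma dim_zero_mod: "KV.dim {0 :: nat \<Rightarrow> 'a fract} = 0"
  using L.dim_basis_of[OF basis_of_zero] by simp

lemma free_chain_dim:
  assumes T: "free_chain n T"
  shows "KV.dim ` T \<subseteq> {1..<n}" "inj_on KV.dim T"
proof -
  show "KV.dim ` T \<subseteq> {1..<n}"
  proof
    fix k assume "k \<in> KV.dim ` T"
    then obtain V where "k = KV.dim V" "V \<in> T" by blast
    then have V: "k = KV.dim V" "free_summand n V" "V \<noteq> {0}" "V \<noteq> std_mod (loc_ring S) n"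
      using T by (simp_all add: free_chain_def)
    note b = free_summand_bounds[OF V(2)]
    have "KV.dim {0 :: nat \<Rightarrow> 'a fract} < k" unfolding V(1)
      using b V by (intro free_summand_dim_less[OF free_summand_zero V(2)]) blast
    moreover have "k < KV.dim (std_mod (loc_ring S) n)" unfolding V(1)
      using b V by (intro free_summand_dim_less[OF V(2) free_summand_std_mod]) blast
    ultimately show "k \<in> {1..<n}" by (simp add: L.dim_std_mod)
  qed
  show "inj_on KV.dim T"
  proof (rule inj_onI)
    fix V V' assume V: "V \<in> T" "V' \<in> T" "KV.dim V = KV.dim V'"
    then have *: "free_summand n V" "free_summand n V'" "V \<subseteq> V' \<or> V' \<subseteq> V"
      using T by (simp_all add: free_chain_def)
    then show "V = V'"
      using free_summand_subset_iff_dim_le[OF *] free_summand_subset_iff_dim_le[of n V' V] V(3) by auto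
  qed
qed

text \<open>Interpolate between the members Lo and Up whose dimensions are closest to d from below
  and above. Every other member is contained in Lo or contains Up, so the new one is comparable with
  all.\<close>

lemma free_chain_extend:
  assumes T: "free_chain n T" and d: "d \<in> {1..<n}" "d \<notin> KV.dim ` T"
  obtains V where "free_chain n (insert V T)" "V \<notin> T"
proof -
  \<comment> \<open>The two end points guarantee that d has a neighbour on either side.\<close>
  define T' where "T' = insert {0} (insert (std_mod (loc_ring S) n) T)"
  have finT': "finite T'" using T by (simp add: T'_def free_chain_def)
  have fs: "free_summand n V" if "V \<in> T'" for V
    using that T free_summand_zero free_summand_std_mod by (auto simp: T'_def free_chain_def)
  have chain: "V \<subseteq> V' \<or> V' \<subseteq> V" if "V \<in> T'" "V' \<in> T'" for V V'
  proof (cases "V \<in> T \<and> V' \<in> T")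
    case True
    then show ?thesis using T by (simp add: free_chain_def)
  next
    case False
    then have "V = {0} \<or> V' = {0} \<or> V = std_mod (loc_ring S) n \<or> V' = std_mod (loc_ring S) n"
      using that by (auto simp: T'_def)
    then show ?thesis
      using free_summand_bounds[OF fs[OF that(1)]] free_summand_bounds[OF fs[OF that(2)]] by blast
  qed
  have dT': "KV.dim V \<noteq> d" if "V \<in> T'" for V
    using that d by (auto simp: T'_def dim_zero_mod L.dim_std_mod)
  define X where "X = {V \<in> T'. KV.dim V < d}"
  define Y where "Y = {V \<in> T'. d < KV.dim V}"
  have "{0} \<in> X" "std_mod (loc_ring S) n \<in> Y"
    using d by (auto simp: X_def Y_def T'_def dim_zero_mod L.dim_std_mod)
  then have XY: "finite X" "X \<noteq> {}" "finite Y" "Y \<noteq> {}" using finT' by (auto simp: X_def Y_def)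
  have "Max (KV.dim ` X) \<in> KV.dim ` X" using XY by (intro Max_in) auto
  then obtain Lo where "Lo \<in> X" "Max (KV.dim ` X) = KV.dim Lo" by (rule imageE) simp
  then have Lo: "Lo \<in> X" "V \<in> X \<Longrightarrow> KV.dim V \<le> KV.dim Lo" for V
    using Max_ge[of "KV.dim ` X" "KV.dim V"] XY(1) by auto
  have "Min (KV.dim ` Y) \<in> KV.dim ` Y" using XY by (intro Min_in) auto
  then obtain Up where "Up \<in> Y" "Min (KV.dim ` Y) = KV.dim Up" by (rule imageE) simp
  then have Up: "Up \<in> Y" "V \<in> Y \<Longrightarrow> KV.dim Up \<le> KV.dim V" for V
    using Min_le[of "KV.dim ` Y" "KV.dim V"] XY(3) by auto
  have LU: "Lo \<in> T'" "Up \<in> T'" "KV.dim Lo < d" "d < KV.dim Up" using Lo(1) Up(1) by (auto simp: X_def Y_def)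
  have le: "V \<subseteq> V'" if "V \<in> T'" "V' \<in> T'" "KV.dim V \<le> KV.dim V'" for V V'
    using free_summand_subset_iff_dim_le[OF fs[OF that(1)] fs[OF that(2)] chain[OF that(1,2)]] that(3) by simp
  have "Lo \<subseteq> Up" using le[OF LU(1,2)] LU(3,4) by simp
  then obtain V where V: "free_summand n V" "Lo \<subseteq> V" "V \<subseteq> Up" "KV.dim V = d"
    by (rule free_summand_interpolate[OF fs[OF LU(1)] fs[OF LU(2)] _ LU(3,4)])
  have comp: "V \<subseteq> V' \<or> V' \<subseteq> V" if "V' \<in> T" for V'
  proof -
    have V': "V' \<in> T'" using that by (simp add: T'_def)
    show ?thesis
    proof (cases "KV.dim V' < d")
      case True
      then have "V' \<subseteq> Lo" using le[OF V' LU(1)] Lo(2)[of V'] V' by (simp add: X_def)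
      then show ?thesis using V(2) by blast
    next
      case False
      then have "V' \<in> Y" using dT'[OF V'] V' by (simp add: Y_def)
      then have "Up \<subseteq> V'" using le[OF LU(2) V'] Up(2) by simp
      then show ?thesis using V(3) by blast
    qed
  qed
  have "V \<noteq> {0}" "V \<noteq> std_mod (loc_ring S) n" using V(4) d(1) by (auto simp: dim_zero_mod L.dim_std_mod)
  then have "free_chain n (insert V T)"
    unfolding free_chain_def using T[unfolded free_chain_def] V(1) comp by auto
  moreover have "V \<notin> T" using V(4) d(2) by blast
  ultimately show thesis by (rule that)
qed

lemma free_chain_completes:
  assumes "free_chain n T"
  shows "\<exists>T'. T \<subseteq> T' \<and> free_chain n T' \<and> KV.dim ` T' = {1..<n}"
  using assms
proof (induction "n - card T" arbitrary: T rule: less_induct)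
  case less
  show ?case
  proof (cases "KV.dim ` T = {1..<n}")
    case True
    then show ?thesis using less.prems by blast
  next
    case False
    then obtain d where d: "d \<in> {1..<n}" "d \<notin> KV.dim ` T" using free_chain_dim(1)[OF less.prems] by blast
    obtain V where V: "free_chain n (insert V T)" "V \<notin> T" using free_chain_extend[OF less.prems d] .
    have "card T = card (KV.dim ` T)" using free_chain_dim(2)[OF less.prems] by (simp add: card_image)
    also have "\<dots> \<le> card {1..<n}" using free_chain_dim(1)[OF less.prems] by (intro card_mono) auto
    finally have "card T < n" using d(1) by auto
    moreover have "card (insert V T) = Suc (card T)" using V less.prems by (simp add: free_chain_def)
    ultimately have "n - card (insert V T) < n - card T" by simp
    from less.hyps[OF this V(1)] show ?thesis by blast
  qed
qed

text \<open>In a completed chain each dimension 1, ..., n - 1 occurs exactly once, so listing the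
  members by dimension gives a strictly increasing list of length n - 1.\<close>

lemma free_chain_in_complete_flag:
  assumes "free_chain n T"
  obtains Vs where "complete_flag (loc_ring S) n Vs" "T \<subseteq> set Vs"
proof -
  obtain T' where T': "T \<subseteq> T'" "free_chain n T'" "KV.dim ` T' = {1..<n}"
    using free_chain_completes[OF assms] by blast
  define g where "g = inv_into T' KV.dim"
  have g: "g d \<in> T'" "KV.dim (g d) = d" if "d \<in> {1..<n}" for d
    unfolding g_def using that T'(3) by (auto intro: inv_into_into f_inv_into_f)
  define Vs where "Vs = map g [1..<n]"
  have "set Vs = T'"
  proof (intro equalityI subsetI)
    fix V assume V: "V \<in> T'"
    then have "KV.dim V \<in> {1..<n}" using T'(3) by blast
    moreover have "g (KV.dim V) = V" unfolding g_def using free_chain_dim(2)[OF T'(2)] V by (rule inv_into_f_f)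
    ultimately show "V \<in> set Vs" unfolding Vs_def by force
  qed (use g in \<open>auto simp: Vs_def\<close>)
  moreover have "sorted_wrt (\<subset>) Vs"
  proof -
    have "g i \<subset> g j" if "i \<in> {1..<n}" "j \<in> {1..<n}" "i < j" for i j
    proof -
      have *: "free_summand n (g i)" "free_summand n (g j)" "g i \<subseteq> g j \<or> g j \<subseteq> g i"
        using T'(2) g(1)[OF that(1)] g(1)[OF that(2)] unfolding free_chain_def by blast+
      then have "g i \<subseteq> g j" using free_summand_subset_iff_dim_le[OF *] g(2) that by simp
      moreover have "g i \<noteq> g j" using g(2)[OF that(1)] g(2)[OF that(2)] that(3) by auto
      ultimately show ?thesis by blast
    qed
    then show ?thesis unfolding Vs_def sorted_wrt_map
      by (intro sorted_wrt_mono_rel[OF _ sorted_wrt_upt]) auto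
  qed
  ultimately have "complete_flag (loc_ring S) n Vs"
    unfolding complete_flag_def is_flag_def
    using T'(2) by (auto simp: free_chain_def free_summand_def Vs_def)
  then show thesis using that T'(1) \<open>set Vs = T'\<close> by blast
qed

section \<open>Comparison of simplices\<close>

text \<open>Every chain of free summands over R_S extends to a complete flag, so goodness of a flag
  is automatic and only pairwise inclusion remains.\<close>

lemma tits_simplex_iff:
  "tits_simplex (loc_ring S) n \<tau> \<longleftrightarrow> finite \<tau> \<and> \<tau> \<noteq> {} \<and> (\<forall>V\<in>\<tau>. tits_vertex (loc_ring S) n V)
    \<and> (\<forall>V\<in>\<tau>. \<forall>V'\<in>\<tau>. V \<subseteq> V' \<or> V' \<subseteq> V)"
proof (intro iffI conjI)
  assume t: "tits_simplex (loc_ring S) n \<tau>"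
  then show "finite \<tau>" "\<tau> \<noteq> {}" "\<forall>V\<in>\<tau>. tits_vertex (loc_ring S) n V" by (auto simp: tits_simplex_def)
  obtain Vs where Vs: "sorted_wrt (\<subset>) Vs" "\<tau> \<subseteq> set Vs"
    using t unfolding tits_simplex_def complete_flag_def is_flag_def by blast
  have comp: "Vs ! i \<subseteq> Vs ! j \<or> Vs ! j \<subseteq> Vs ! i" if "i < length Vs" "j < length Vs" for i j
    using Vs(1) that unfolding sorted_wrt_iff_nth_less by (cases i j rule: linorder_cases) auto
  show "\<forall>V\<in>\<tau>. \<forall>V'\<in>\<tau>. V \<subseteq> V' \<or> V' \<subseteq> V"
  proof (intro ballI)
    fix V V' assume "V \<in> \<tau>" "V' \<in> \<tau>"
    then have "V \<in> set Vs" "V' \<in> set Vs" using Vs(2) by auto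
    then obtain i j where "i < length Vs" "V = Vs ! i" "j < length Vs" "V' = Vs ! j"
      unfolding in_set_conv_nth by blast
    then show "V \<subseteq> V' \<or> V' \<subseteq> V" using comp by simp
  qed
next
  assume \<tau>: "finite \<tau> \<and> \<tau> \<noteq> {} \<and> (\<forall>V\<in>\<tau>. tits_vertex (loc_ring S) n V) \<and> (\<forall>V\<in>\<tau>. \<forall>V'\<in>\<tau>. V \<subseteq> V' \<or> V' \<subseteq> V)"
  then have "free_chain n \<tau>" by (simp add: free_chain_def free_summand_def tits_vertex_def)
  then obtain Vs where "complete_flag (loc_ring S) n Vs" "\<tau> \<subseteq> set Vs" by (rule free_chain_in_complete_flag)
  then show "tits_simplex (loc_ring S) n \<tau>" using \<tau> by (auto simp: tits_simplex_def)
qed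

text \<open>P is cut out of R^n by a subspace, and the projection onto that subspace restricts to Q,
  so P splits off from Q whenever it is contained in it.\<close>

lemma summand_less_iff:
  assumes P: "rel_vertex S n P" and Q: "rel_vertex S n Q"
  shows "summand_less base_ring P Q \<longleftrightarrow> P \<subset> Q"
proof
  assume PQ: "P \<subset> Q"
  obtain W where W: "KV.subspace W" "W \<subseteq> std_mod UNIV n" "P = W \<inter> std_mod base_ring n"
    using rel_vertexE[OF P] by metis
  have "is_submod base_ring Q" "Q \<subseteq> std_mod base_ring n" using Q by (auto simp: rel_vertex_def direct_summand_def)
  then have "direct_summand base_ring P Q"
    unfolding W(3) using PQ W(3) by (intro base_direct_summand_Int_of_subset W) auto
  then show "summand_less base_ring P Q" using PQ by (simp add: summand_less_def)
qed (simp add: summand_less_def)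

lemma tensor_loc_subset_iff:
  assumes P: "rel_vertex S n P" and Q: "rel_vertex S n Q"
  shows "tensor_loc S P \<subseteq> tensor_loc S Q \<longleftrightarrow> P \<subseteq> Q"
proof
  assume "P \<subseteq> Q"
  then show "tensor_loc S P \<subseteq> tensor_loc S Q" unfolding tensor_loc_def by (rule L.span_in_mono)
next
  assume "tensor_loc S P \<subseteq> tensor_loc S Q"
  then show "P \<subseteq> Q" using tits_vertex_tensor_loc(2)[OF P] tits_vertex_tensor_loc(2)[OF Q] by blast
qed

lemma bij_betw_tensor_loc:
  "bij_betw (tensor_loc S) {P. rel_vertex S n P} {V. tits_vertex (loc_ring S) n V}"
  by (rule bij_betw_byWitness[where f' = "\<lambda>V. V \<inter> std_mod base_ring n"])
    (auto simp: tits_vertex_tensor_loc rel_vertex_Int_base)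

lemma rel_simplex_iff_tits_simplex:
  assumes \<sigma>: "\<sigma> \<subseteq> {P. rel_vertex S n P}"
  shows "rel_simplex S n \<sigma> \<longleftrightarrow> tits_simplex (loc_ring S) n (tensor_loc S ` \<sigma>)"
proof -
  have inj: "inj_on (tensor_loc S) \<sigma>"
    using bij_betw_tensor_loc \<sigma> by (meson bij_betw_imp_inj_on inj_on_subset)
  have "rel_simplex S n \<sigma> \<longleftrightarrow> finite \<sigma> \<and> \<sigma> \<noteq> {} \<and> (\<forall>P\<in>\<sigma>. \<forall>Q\<in>\<sigma>. P \<subseteq> Q \<or> Q \<subseteq> P)"
  proof -
    have "(P = Q \<or> summand_less base_ring P Q \<or> summand_less base_ring Q P) \<longleftrightarrow> P \<subseteq> Q \<or> Q \<subseteq> P"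
      if "P \<in> \<sigma>" "Q \<in> \<sigma>" for P Q
      using summand_less_iff[of n P Q] summand_less_iff[of n Q P] \<sigma> that by blast
    then show ?thesis unfolding rel_simplex_def using \<sigma> by (metis (no_types, lifting) mem_Collect_eq subsetD)
  qed
  also have "\<dots> \<longleftrightarrow> finite (tensor_loc S ` \<sigma>) \<and> tensor_loc S ` \<sigma> \<noteq> {}
      \<and> (\<forall>V\<in>tensor_loc S ` \<sigma>. \<forall>V'\<in>tensor_loc S ` \<sigma>. V \<subseteq> V' \<or> V' \<subseteq> V)"
  proof -
    have "(tensor_loc S P \<subseteq> tensor_loc S Q \<or> tensor_loc S Q \<subseteq> tensor_loc S P) \<longleftrightarrow> P \<subseteq> Q \<or> Q \<subseteq> P"
      if "P \<in> \<sigma>" "Q \<in> \<sigma>" for P Q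
      using tensor_loc_subset_iff[of n P Q] tensor_loc_subset_iff[of n Q P] \<sigma> that by blast
    then show ?thesis using finite_image_iff[OF inj] by (simp add: ball_simps)
  qed
  also have "\<dots> \<longleftrightarrow> tits_simplex (loc_ring S) n (tensor_loc S ` \<sigma>)"
    unfolding tits_simplex_iff using \<sigma> tits_vertex_tensor_loc(1) by blast
  finally show ?thesis .
qed

end

theorem mainTheorem16:
  fixes S :: "'a::idom set" and n :: nat
  assumes "dedekind_domain TYPE('a)"
    and "1 \<in> S" and "\<forall>s\<in>S. \<forall>t\<in>S. s * t \<in> S" and "0 \<notin> S"
    and "n \<ge> 1"
  shows "bij_betw (tensor_loc S) {P. rel_vertex S n P} {V. tits_vertex (loc_ring S) n V}
    \<and> (\<forall>V. tits_vertex (loc_ring S) n V \<longrightarrow>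
          rel_vertex S n (V \<inter> std_mod base_ring n) \<and> tensor_loc S (V \<inter> std_mod base_ring n) = V)
    \<and> (\<forall>\<sigma>. \<sigma> \<subseteq> {P. rel_vertex S n P} \<longrightarrow>
          (rel_simplex S n \<sigma> \<longleftrightarrow> tits_simplex (loc_ring S) n (tensor_loc S ` \<sigma>)))"
proof -
  interpret dedekind_localization S using assms by unfold_locales auto
  show ?thesis using bij_betw_tensor_loc rel_vertex_Int_base rel_simplex_iff_tits_simplex by simp
qed

end
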